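(* Let $X\subset\mathbb{R}^d$ be compact and let $\mu$ be a $\delta$-Ahlfors regular Borel probability measure on $X$. Let $\nu$ be a Borel probability measure on $X$ which is quasi-self-conformal with respect to a collection $\mathcal{F}=\{F_n\}$ of closed subsets of $X$, and assume \[\mu\Big(\limsup_{n\to\infty}F_n\Big)=1.\] Suppose there exist a sequence of balls $\{B(x_n,r_n)\}$ in $X$ and a sequence of open sets $\{E_n\}$ in $X$ such that: (1) $r_n\to 0$ as $n\to\infty$; (2) $\nu\big(\limsup_{n\to\infty}B(x_n,r_n)\big)=1$; (3) $E_n\subset B(x_n,r_n)$ for every $n$, and there is a constant $s\ge 0$ and a constant $c>0$ independent of $n$ such that $\mathcal{H}^s_\infty(E_n)\ge c\, r_n^{\overline{\dim}_{\mathrm H}\nu}$ for all $n$. Then $\limsup_{n\to\infty}E_n\in\mathscr{G}^s(X)$.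
   Context: A Borel probability measure $\mu$ on $X$ is $\delta$-Ahlfors regular if there is a constant $c\ge1$ with $c^{-1}r^\delta\le\mu(B(x,r))\le c r^\delta$ for all $x\in X$ and all $0<r\le |X|$. For a set $A$, $|A|$ denotes its diameter. Quasi-self-conformality: $\nu$ is quasi-self-conformal with respect to $\mathcal{F}=\{F_n\}$ if there is a constant $C\ge1$ such that for every $F_n\in\mathcal F$ there is a bijection $f_n:F_n\to X$ with (i) $C^{-1}\frac{|x-y|}{|F_n|}\le|f_n(x)-f_n(y)|\le C\frac{|x-y|}{|F_n|}$ for all $x,y\in F_n$, and (ii) the normalized pushforward $\nu^{(n)}(A):=\nu(f_n^{-1}(A))/\nu(F_n)$ satisfies $C^{-1}\nu(A)\le\nu^{(n)}(A)\le C\nu(A)$ for every Borel set $A\subset X$. The lower local dimension of $\nu$ at $x$ is $\underline{D}(\nu,x)=\liminf_{r\to0}\frac{\log\nu(B(x,r))}{\log r}$, and the upper Hausdorff dimension of $\nu$ is $\overline{\dim}_{\mathrm H}\nu:=\operatorname{ess\,sup}_\nu \underline{D}(\nu,x)$ (equivalently $\inf\{\dim_{\mathrm H}E: E \text{ Borel}, \nu(E)=1\}$). For $s\ge0$ and $A\subset\mathbb{R}^d$, the $s$-dimensional Hausdorff content is $\mathcal{H}^s_\infty(A)=\inf\{\sum_i|B_i|^s: A\subset\bigcup_i B_i,\ B_i\text{ balls}\}$. For $0<s\le\dim_{\mathrm H}X$, $\mathscr{G}^s(X)$ is the class of $G_\delta$ subsets $A\subset X$ for which there is a constant $c>0$ such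 that for every $0<t<s$ and every ball $B\subset X$, $\mathcal{H}^t_\infty(A\cap B)>c\,\mathcal{H}^t_\infty(B)$.
   Formalization: The formal theorem additionally assumes |F_n| → 0; without it the claim fails, e.g. X=[0,1], μ Lebesgue, F_n=X with f_n the identity, ν normalized Lebesgue on [0,1/2], and E_n=B(x_n,r_n) contained in [0,1/2], s=1. *)

theory Defs
  imports "HOL-Probability.Probability"
begin

text \<open>
  A Borel probability measure on a set \<open>X\<close> lives on the subspace \<open>X\<close> itself, so its space is \<open>X\<close>.
  The balls of \<open>X\<close> are the sets \<open>ball x r \<inter> X\<close> with \<open>x \<in> X\<close> and \<open>r > 0\<close>.
\<close>

definition borel_prob_on :: "'a::metric_space set \<Rightarrow> 'a measure \<Rightarrow> bool" where
  "borel_prob_on X M \<longleftrightarrow> prob_space M \<and> sets M = sets (restrict_space borel X)"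

definition ahlfors_regular :: "'a::metric_space set \<Rightarrow> real \<Rightarrow> 'a measure \<Rightarrow> bool" where
  "ahlfors_regular X \<delta> \<mu> \<longleftrightarrow> borel_prob_on X \<mu> \<and>
     (\<exists>c\<ge>1. \<forall>x\<in>X. \<forall>r. 0 < r \<and> r \<le> diameter X \<longrightarrow>
        inverse c * r powr \<delta> \<le> measure \<mu> (ball x r \<inter> X) \<and>
        measure \<mu> (ball x r \<inter> X) \<le> c * r powr \<delta>)"

text \<open>
  If \<open>\<nu> (F n) = 0\<close>, the quotient \<open>\<nu> (f\<^sup>-\<^sup>1 A) / \<nu> (F n)\<close> is \<open>0\<close> here, and the lower bound for \<open>A = X\<close>
  fails.  So the definition enforces \<open>\<nu> (F n) > 0\<close>, without which \<open>\<nu>\<close> could not be normalized.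
\<close>

definition quasi_self_conformal :: "'a::metric_space set \<Rightarrow> 'a measure \<Rightarrow> (nat \<Rightarrow> 'a set) \<Rightarrow> bool" where
  "quasi_self_conformal X \<nu> F \<longleftrightarrow>
     (\<exists>C\<ge>1. \<forall>n. \<exists>f. bij_betw f (F n) X \<and>
        (\<forall>x\<in>F n. \<forall>y\<in>F n.
           inverse C * (dist x y / diameter (F n)) \<le> dist (f x) (f y) \<and>
           dist (f x) (f y) \<le> C * (dist x y / diameter (F n))) \<and>
        (\<forall>A\<in>sets \<nu>.
           inverse C * measure \<nu> A \<le> measure \<nu> (f -` A \<inter> F n) / measure \<nu> (F n) \<and>
           measure \<nu> (f -` A \<inter> F n) / measure \<nu> (F n) \<le> C * measure \<nu> A))"

text \<open>
  Since \<open>ln 0 = 0\<close> in HOL, the value \<open>log 0 / log r = \<infinity>\<close> (for \<open>r < 1\<close>) is put in by hand.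
\<close>

definition lower_local_dim :: "'a::metric_space measure \<Rightarrow> 'a \<Rightarrow> ereal" where
  "lower_local_dim \<nu> x = Liminf (at_right 0) (\<lambda>r.
     if measure \<nu> (ball x r \<inter> space \<nu>) = 0 then \<infinity>
     else ereal (ln (measure \<nu> (ball x r \<inter> space \<nu>)) / ln r))"

definition upper_hausdorff_dim :: "'a::metric_space measure \<Rightarrow> ereal" where
  "upper_hausdorff_dim \<nu> = esssup \<nu> (lower_local_dim \<nu>)"

text \<open>
  Countable covers by balls are given by sequences of centres and radii.  A radius \<open>r i \<le> 0\<close> yields
  the empty ball, whose contribution is \<open>0 powr s = 0\<close> for every \<open>s\<close>, including \<open>s = 0\<close>; hence
  finite covers are included.  A ball of positive radius contributes \<open>1\<close> when \<open>s = 0\<close>.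
\<close>

definition hausdorff_content :: "real \<Rightarrow> 'a::euclidean_space set \<Rightarrow> ennreal" where
  "hausdorff_content s A =
     (INF (x, r) \<in> {(x :: nat \<Rightarrow> 'a, r :: nat \<Rightarrow> real). A \<subseteq> (\<Union>i. ball (x i) (r i))}.
        \<Sum>i. ennreal (diameter (ball (x i) (r i)) powr s))"

text \<open>
  The Hausdorff measure is taken in its spherical form, in line with the content above.  It agrees
  with the one defined by arbitrary covers up to a factor at most \<open>2 powr s\<close>, so that it has the
  same null sets and gives the same dimension.
\<close>

definition hausdorff_measure :: "real \<Rightarrow> 'a::euclidean_space set \<Rightarrow> ennreal" where
  "hausdorff_measure s A =
     (SUP \<rho> \<in> {0<..}.
        INF (x, r) \<in> {(x :: nat \<Rightarrow> 'a, r :: nat \<Rightarrow> real).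
                      A \<subseteq> (\<Union>i. ball (x i) (r i)) \<and> (\<forall>i. diameter (ball (x i) (r i)) \<le> \<rho>)}.
          \<Sum>i. ennreal (diameter (ball (x i) (r i)) powr s))"

definition hausdorff_dim :: "'a::euclidean_space set \<Rightarrow> ereal" where
  "hausdorff_dim A = Inf {ereal s |s. 0 \<le> s \<and> hausdorff_measure s A = 0}"

text \<open>
  The class \<open>\<G>\<^sup>s(X)\<close>, for \<open>s \<le> dim X\<close>.  The value \<open>s = 0\<close> is admitted by the same formula, where the
  content condition is vacuous and the class consists of all \<open>G\<^sub>\<delta>\<close> subsets of \<open>X\<close>.
\<close>

definition large_intersection_class :: "real \<Rightarrow> 'a::euclidean_space set \<Rightarrow> 'a set set" where
  "large_intersection_class s X =
     {A. 0 \<le> s \<and> ereal s \<le> hausdorff_dim X \<and> gdelta_in (top_of_set X) A \<and>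
         (\<exists>c>0. \<forall>t. 0 < t \<and> t < s \<longrightarrow>
            (\<forall>x\<in>X. \<forall>r>0. hausdorff_content t (A \<inter> (ball x r \<inter> X)) >
               ennreal c * hausdorff_content t (ball x r \<inter> X)))}"

end

theory Submission
  imports Defs
begin

text \<open>
  Let \<open>W\<close> be the measure on indices that gives a ball \<open>B i\<close> of a cover of
  \<open>limsup E \<inter> ball z R\<close> the mass \<open>\<bar>B i\<bar>\<^sup>t\<close>, and call a ball light if the \<open>B i\<close> that hit it have mass
  less than \<open>c1\<close> times the \<open>t\<close>-th power of its radius.  If \<open>ball z R\<close> is light, there is a nested
  sequence of light balls, the \<open>N\<close>-th of which has its trace on \<open>X\<close> in \<open>\<Union>n\<ge>N. E n\<close>; its
  limit point lies in \<open>limsup E\<close> but in no \<open>B i\<close>, so covers cannot be cheap.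

  A light ball can always be refined: otherwise all small balls in \<open>E n\<close> are heavy.  One Vitali
  argument is then applied at three levels.  Heavy balls in \<open>E n\<close> and the content of \<open>E n\<close> bound
  \<open>r n\<close> to the power \<open>p = D - (s - t)\<close> by the mass near \<open>ball (x n) (r n)\<close>, where \<open>D\<close> is the
  dimension of \<open>\<nu>\<close>.  Since \<open>p < D\<close>, sets of full \<open>\<nu>\<close>-measure have \<open>p\<close>-content bounded below, and by
  quasi-self-conformality so does their trace on \<open>F n\<close>, after rescaling; hence \<open>\<bar>F n\<bar>\<^sup>p\<close> is bounded by
  the mass near \<open>F n\<close>.  As \<open>p < \<delta>\<close>, arbitrarily small \<open>F n\<close> that cover \<open>\<mu>\<close>-almost everything would
  need too much mass.  The constant \<open>c1\<close> depends only on the regularity of \<open>\<mu>\<close>, not on \<open>t\<close>.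
\<close>

section \<open>Hausdorff content\<close>

text \<open>Truncating at 0 makes the empty balls of nonpositive radius free of charge, also for
  \<open>p = 0\<close> because \<open>0 powr 0 = 0\<close>. So radii of covers carry no sign
  condition.\<close>

abbreviation ball_cost :: "real \<Rightarrow> real \<Rightarrow> ennreal" where
  "ball_cost p r \<equiv> ennreal ((2 * max 0 r) powr p)"

lemma hausdorff_content_eq:
  fixes A :: "'a::euclidean_space set"
  shows "hausdorff_content p A =
     (INF (x, r) \<in> {(x :: nat \<Rightarrow> 'a, r :: nat \<Rightarrow> real). A \<subseteq> (\<Union>i. ball (x i) (r i))}.
        \<Sum>i. ball_cost p (r i))"
proof -
  have "diameter (ball x r) = 2 * max 0 r" for x :: 'a and r :: real
    by auto
  then show ?thesis unfolding hausdorff_content_def by presburger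
qed

lemma hausdorff_content_le_countable:
  fixes A :: "'a::euclidean_space set"
  assumes J: "countable J" and A: "A \<subseteq> (\<Union>j\<in>J. ball (a j) (b j))"
  shows "hausdorff_content p A \<le> (\<integral>\<^sup>+ j. ball_cost p (b j) \<partial>count_space J)"
proof -
  define N where "N = to_nat_on J ` J"
  define g where "g = inv_into J (to_nat_on J)"
  have inj: "inj_on (to_nat_on J) J" using J by (rule inj_on_to_nat_on)
  then have bij: "bij_betw g N J"
    unfolding N_def g_def by (intro bij_betw_inv_into inj_on_imp_bij_betw)
  define a' where "a' n = a (g n)" for n
  define b' where "b' n = (if n \<in> N then b (g n) else 0)" for n
  have sub: "A \<subseteq> (\<Union>n. ball (a' n) (b' n))"
  proof
    fix x assume "x \<in> A"
    then obtain j where j: "j \<in> J" "x \<in> ball (a j) (b j)" using A by blast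
    then obtain n where "n \<in> N" "g n = j" using bij by (auto simp: bij_betw_def)
    then show "x \<in> (\<Union>n. ball (a' n) (b' n))" using j by (auto simp: a'_def b'_def)
  qed
  have "hausdorff_content p A \<le> (\<Sum>n. ball_cost p (b' n))"
    unfolding hausdorff_content_eq by (rule INF_lower2[of "(a', b')"]) (use sub in auto)
  also have "\<dots> = (\<integral>\<^sup>+ n. ball_cost p (b (g n)) * indicator N n \<partial>count_space UNIV)"
    by (simp add: nn_integral_count_space_nat[symmetric])
       (rule nn_integral_cong, simp add: b'_def)
  also have "\<dots> = (\<integral>\<^sup>+ n. ball_cost p (b (g n)) \<partial>count_space N)"
    by (simp add: nn_integral_count_space_indicator)
  also have "\<dots> = (\<integral>\<^sup>+ j. ball_cost p (b j) \<partial>count_space J)"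
    by (rule nn_integral_bij_count_space[OF bij])
  finally show ?thesis .
qed

lemma hausdorff_content_lessE:
  fixes A :: "'a::euclidean_space set"
  assumes "hausdorff_content p A < K"
  obtains a b where "A \<subseteq> (\<Union>i. ball (a i) (b i))" "(\<Sum>i. ball_cost p (b i)) < K"
  using assms unfolding hausdorff_content_eq INF_less_iff by auto

lemma hausdorff_content_mono:
  "A \<subseteq> B \<Longrightarrow> hausdorff_content p A \<le> hausdorff_content p B"
  unfolding hausdorff_content_def by (rule INF_superset_mono) auto

lemma hausdorff_content_ball_le:
  "hausdorff_content p (ball x r) \<le> ball_cost p r"
  using hausdorff_content_le_countable[of "{0::nat}" "ball x r" "\<lambda>_. x" "\<lambda>_. r" p]
  by (simp add: nn_integral_count_space_finite)

lemma nn_integral_count_space_Plus: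
  "(\<integral>\<^sup>+ j. f j \<partial>count_space (A <+> B)) =
   (\<integral>\<^sup>+ a. f (Inl a) \<partial>count_space A) + (\<integral>\<^sup>+ b. f (Inr b) \<partial>count_space B)"
proof -
  have bijs: "bij_betw Inl A (Inl ` A)" "bij_betw Inr B (Inr ` B)"
    by (auto simp: bij_betw_def)
  have "(\<integral>\<^sup>+ j. f j \<partial>count_space (A <+> B)) =
        (\<integral>\<^sup>+ j. f j * indicator (Inl ` A) j + f j * indicator (Inr ` B) j \<partial>count_space UNIV)"
    by (subst nn_integral_count_space_indicator) (auto intro!: nn_integral_cong split: split_indicator)
  also have "\<dots> = (\<integral>\<^sup>+ j. f j \<partial>count_space (Inl ` A)) + (\<integral>\<^sup>+ j. f j \<partial>count_space (Inr ` B))"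
    by (simp add: nn_integral_add nn_integral_count_space_indicator)
  also have "\<dots> = (\<integral>\<^sup>+ a. f (Inl a) \<partial>count_space A) + (\<integral>\<^sup>+ b. f (Inr b) \<partial>count_space B)"
    by (simp only: nn_integral_bij_count_space[OF bijs(1), symmetric] nn_integral_bij_count_space[OF bijs(2), symmetric])
  finally show ?thesis .
qed

section \<open>A Vitali estimate for the content\<close>

text \<open>Meeting \<open>S\<close> suffices, so that a cover ball around the common point of
  nested balls is counted at every stage.\<close>

definition hits :: "(nat \<Rightarrow> 'a::metric_space) \<Rightarrow> (nat \<Rightarrow> real) \<Rightarrow> 'a set \<Rightarrow> nat set" where
  "hits y \<rho> S = {i. ball (y i) (\<rho> i) \<inter> S \<noteq> {}}"

lemma hits_mono: "S \<subseteq> T \<Longrightarrow> hits y \<rho> S \<subseteq> hits y \<rho> T"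
  by (auto simp: hits_def)

lemma hits_ballD:
  assumes "i \<in> hits y \<rho> (ball u s)"
  shows "0 < \<rho> i" "dist u (y i) < s + \<rho> i"
proof -
  obtain v where v: "dist (y i) v < \<rho> i" "dist u v < s"
    using assms by (auto simp: hits_def)
  then show "0 < \<rho> i" using le_less_trans[OF zero_le_dist] by blast
  show "dist u (y i) < s + \<rho> i"
    using v dist_triangle[of u "y i" v] by (simp add: dist_commute)
qed

lemma emeasure_eq_nn_integral_singletons:
  fixes W :: "nat measure"
  assumes [simp]: "sets W = UNIV"
  shows "emeasure W I = (\<integral>\<^sup>+ i. emeasure W {i} \<partial>count_space I)"
proof -
  have "emeasure W (\<Union>i\<in>I. {i}) = (\<integral>\<^sup>+ i. emeasure W {i} \<partial>count_space I)"
    by (rule emeasure_UN_countable) (auto simp: disjoint_family_on_def)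
  then show ?thesis by simp
qed

text \<open>The 5-fold dilations of the balls in \<open>I\<close> cover part of \<open>A\<close> at
  a cost of at most \<open>\<alpha>\<close> times the mass of \<open>I\<close>. For the remaining
  points, Vitali's lemma selects disjoint balls among the doubled balls
  \<open>ball u (2 * s u)\<close>. Doubling is what prevents an index from being counted for two
  selected points. Dilating a selected doubled ball by 5 gives diameter \<open>20 * s u\<close>,
  whence \<open>20 powr p\<close>.\<close>

lemma vitali_content_bound:
  fixes A :: "'a::euclidean_space set" and W :: "nat measure" and I :: "nat set"
  assumes W: "sets W = UNIV" and p: "p \<ge> 0"
    and bad: "\<And>i. i \<in> I \<Longrightarrow> ball_cost p (5 * \<rho> i) \<le> \<alpha> * emeasure W {i}"
    and good: "\<And>u. u \<in> A \<Longrightarrow> \<forall>i\<in>I. u \<notin> ball (y i) (5 * \<rho> i) \<Longrightarrow>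
       \<exists>s. 0 < s \<and> s \<le> b \<and> hits y \<rho> (ball u s) \<subseteq> I \<and>
           ennreal (s powr p) \<le> \<beta> * emeasure W (hits y \<rho> (ball u s))"
  shows "hausdorff_content p A \<le> (\<alpha> + ennreal (20 powr p) * \<beta>) * emeasure W I"
proof -
  note [simp] = W
  define G where "G = {u \<in> A. \<forall>i\<in>I. u \<notin> ball (y i) (5 * \<rho> i)}"
  have "\<forall>u\<in>G. \<exists>s. 0 < s \<and> s \<le> b \<and> hits y \<rho> (ball u s) \<subseteq> I \<and>
           ennreal (s powr p) \<le> \<beta> * emeasure W (hits y \<rho> (ball u s))"
    using good by (auto simp: G_def)
  then obtain s where s: "\<And>u. u \<in> G \<Longrightarrow> 0 < s u" "\<And>u. u \<in> G \<Longrightarrow> s u \<le> b"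
      "\<And>u. u \<in> G \<Longrightarrow> hits y \<rho> (ball u (s u)) \<subseteq> I"
      "\<And>u. u \<in> G \<Longrightarrow> ennreal (s u powr p) \<le> \<beta> * emeasure W (hits y \<rho> (ball u (s u)))"
    by metis
  let ?H = "\<lambda>u. hits y \<rho> (ball u (s u))"
  have "G \<subseteq> (\<Union>u\<in>G. ball u (2 * s u))" using s(1) by force
  moreover have "0 < 2 * s u \<and> 2 * s u \<le> 2 * b" if "u \<in> G" for u
    using s(1,2)[OF that] by simp
  ultimately obtain C where C: "countable C" "C \<subseteq> G"
      "pairwise (\<lambda>u v. disjnt (ball u (2 * s u)) (ball v (2 * s v))) C"
      "G \<subseteq> (\<Union>u\<in>C. ball u (5 * (2 * s u)))"
    by (rule Vitali_covering_lemma_balls[where a="\<lambda>u. u" and r="\<lambda>u. 2 * s u" and B="2 * b" and S=G])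
       blast
  \<comment> \<open>A ball that hits \<open>ball u (s u)\<close> but whose 5-fold dilation misses \<open>u\<close> is small, so its centre
    lies in \<open>ball u (2 * s u)\<close>.\<close>
  have centre: "y i \<in> ball u (2 * s u)" if u: "u \<in> G" and i: "i \<in> ?H u" for u i
  proof -
    have "i \<in> I" using s(3) u i by blast
    then have "5 * \<rho> i \<le> dist u (y i)" using u by (auto simp: G_def dist_commute)
    then show ?thesis using hits_ballD[OF i] by (simp add: dist_commute)
  qed
  have disj: "disjoint_family_on ?H C"
    unfolding disjoint_family_on_def
  proof (intro ballI impI)
    fix u v assume uv: "u \<in> C" "v \<in> C" "u \<noteq> v"
    then have "disjnt (ball u (2 * s u)) (ball v (2 * s v))"
      using C(3) by (simp add: pairwise_def)
    then show "?H u \<inter> ?H v = {}"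
      using centre uv C(2) by (fastforce simp: disjnt_iff)
  qed
  have "hausdorff_content p A \<le>
      (\<integral>\<^sup>+ j. ball_cost p (case_sum (\<lambda>i. 5 * \<rho> i) (\<lambda>u. 10 * s u) j) \<partial>count_space (I <+> C))"
  proof (rule hausdorff_content_le_countable)
    show "countable (I <+> C)" using C(1) by (simp add: countable_Plus)
    show "A \<subseteq> (\<Union>j\<in>I <+> C. ball (case_sum y (\<lambda>u. u) j) (case_sum (\<lambda>i. 5 * \<rho> i) (\<lambda>u. 10 * s u) j))"
    proof
      fix u assume u: "u \<in> A"
      show "u \<in> (\<Union>j\<in>I <+> C. ball (case_sum y (\<lambda>u. u) j) (case_sum (\<lambda>i. 5 * \<rho> i) (\<lambda>u. 10 * s u) j))"
      proof (cases "u \<in> G")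
        case True
        then obtain v where "v \<in> C" "u \<in> ball v (10 * s v)" using C(4) by auto
        then show ?thesis by (intro UN_I[of "Inr v"]) auto
      next
        case False
        then obtain i where "i \<in> I" "u \<in> ball (y i) (5 * \<rho> i)" using u by (auto simp: G_def)
        then show ?thesis by (intro UN_I[of "Inl i"]) auto
      qed
    qed
  qed
  also have "\<dots> = (\<integral>\<^sup>+ i. ball_cost p (5 * \<rho> i) \<partial>count_space I)
                 + (\<integral>\<^sup>+ u. ball_cost p (10 * s u) \<partial>count_space C)"
    by (simp add: nn_integral_count_space_Plus)
  also have "(\<integral>\<^sup>+ i. ball_cost p (5 * \<rho> i) \<partial>count_space I) \<le> (\<integral>\<^sup>+ i. \<alpha> * emeasure W {i} \<partial>count_space I)"
    by (rule nn_integral_mono) (simp add: bad)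
  also have "\<dots> = \<alpha> * emeasure W I"
    by (simp add: nn_integral_cmult emeasure_eq_nn_integral_singletons[symmetric])
  also have "(\<integral>\<^sup>+ u. ball_cost p (10 * s u) \<partial>count_space C)
      \<le> (\<integral>\<^sup>+ u. ennreal (20 powr p) * (\<beta> * emeasure W (?H u)) \<partial>count_space C)"
  proof (rule nn_integral_mono)
    fix u assume "u \<in> space (count_space C)"
    then have u: "u \<in> G" using C(2) by auto
    have "(2 * max 0 (10 * s u)) powr p = 20 powr p * s u powr p"
      using s(1)[OF u] by (simp add: powr_mult[symmetric])
    then show "ball_cost p (10 * s u) \<le> ennreal (20 powr p) * (\<beta> * emeasure W (?H u))"
      using s(4)[OF u] by (simp add: ennreal_mult mult_left_mono)
  qed
  also have "\<dots> = ennreal (20 powr p) * (\<beta> * emeasure W (\<Union>u\<in>C. ?H u))"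
    using C(1) disj by (simp add: nn_integral_cmult emeasure_UN_countable)
  also have "\<dots> \<le> ennreal (20 powr p) * (\<beta> * emeasure W I)"
    using s(3) C(2) by (intro mult_left_mono emeasure_mono) auto
  finally show ?thesis
    by (simp add: distrib_right mult.assoc add_left_mono add_right_mono)
qed

section \<open>Ahlfors regular measures\<close>

lemma borel_prob_onD:
  assumes "borel_prob_on X \<mu>"
  shows "prob_space \<mu>" "space \<mu> = X" "sets \<mu> = sets (restrict_space borel X)"
proof -
  show "prob_space \<mu>" and s: "sets \<mu> = sets (restrict_space borel X)"
    using assms by (auto simp: borel_prob_on_def)
  show "space \<mu> = X" using sets_eq_imp_space_eq[OF s] by (simp add: space_restrict_space)
qed

lemma borel_prob_on_Int_sets:
  assumes "borel_prob_on X \<mu>" "S \<in> sets borel"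
  shows "S \<inter> X \<in> sets \<mu>"
  unfolding borel_prob_onD(3)[OF assms(1)] sets_restrict_space using assms(2) by auto

text \<open>The mass distribution principle: countable subadditivity over an arbitrary cover, then
  the infimum over covers.\<close>

lemma emeasure_le_content_of_ball_bound:
  fixes X :: "'a::euclidean_space set"
  assumes \<mu>: "borel_prob_on X \<mu>" and A: "A \<subseteq> X" and K: "K > 0"
    and ub: "\<And>y b. 0 < b \<Longrightarrow> emeasure \<mu> (ball y b \<inter> X) \<le> ennreal K * ball_cost p b"
  shows "emeasure \<mu> A \<le> ennreal K * hausdorff_content p A"
proof -
  interpret prob_space \<mu> using borel_prob_onD(1)[OF \<mu>] .
  have *: "emeasure \<mu> A \<le> ennreal K * (\<Sum>i. ball_cost p (b i))"
    if cov: "A \<subseteq> (\<Union>i. ball (a i) (b i))" for a :: "nat \<Rightarrow> 'a" and b :: "nat \<Rightarrow> real"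
  proof -
    have m: "range (\<lambda>i. ball (a i) (b i) \<inter> X) \<subseteq> sets \<mu>"
      using borel_prob_on_Int_sets[OF \<mu>] by auto
    have "emeasure \<mu> A \<le> emeasure \<mu> (\<Union>i. ball (a i) (b i) \<inter> X)"
      using cov A by (intro emeasure_mono sets.countable_nat_UN[OF m]) auto
    also have "\<dots> \<le> (\<Sum>i. emeasure \<mu> (ball (a i) (b i) \<inter> X))"
      by (rule emeasure_subadditive_countably[OF m])
    also have "\<dots> \<le> (\<Sum>i. ennreal K * ball_cost p (b i))"
    proof (intro suminf_le summableI)
      fix i show "emeasure \<mu> (ball (a i) (b i) \<inter> X) \<le> ennreal K * ball_cost p (b i)"
        using ub[of "b i" "a i"] by (cases "b i > 0") (auto simp: ball_empty)
    qed
    finally show ?thesis by simp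
  qed
  have "ennreal (1 / K) * emeasure \<mu> A \<le> hausdorff_content p A"
    unfolding hausdorff_content_eq
  proof (intro INF_greatest, clarify)
    fix a :: "nat \<Rightarrow> 'a" and b :: "nat \<Rightarrow> real"
    assume "A \<subseteq> (\<Union>i. ball (a i) (b i))"
    then have "ennreal (1 / K) * emeasure \<mu> A \<le> ennreal (1 / K) * (ennreal K * (\<Sum>i. ball_cost p (b i)))"
      by (intro mult_left_mono *) auto
    also have "\<dots> = (\<Sum>i. ball_cost p (b i))"
      using K by (simp add: mult.assoc[symmetric] ennreal_mult[symmetric])
    finally show "ennreal (1 / K) * emeasure \<mu> A \<le> (\<Sum>i. ball_cost p (b i))" .
  qed
  then have "ennreal K * (ennreal (1 / K) * emeasure \<mu> A) \<le> ennreal K * hausdorff_content p A"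
    by (rule mult_left_mono) simp
  then show ?thesis
    using K by (simp add: mult.assoc[symmetric] ennreal_mult[symmetric])
qed

text \<open>Lower regularity is kept for balls centred in \<open>X\<close>, while upper regularity
  passes through the mass distribution principle and becomes a content bound for all subsets of
  \<open>X\<close>.\<close>

lemma ahlfors_regularE:
  fixes X :: "'a::euclidean_space set"
  assumes "ahlfors_regular X \<delta> \<mu>" "0 < diameter X" "0 \<le> \<delta>"
  obtains k K where "0 < k"
    "\<forall>x r. x \<in> X \<longrightarrow> 0 < r \<longrightarrow> r \<le> diameter X \<longrightarrow> k * r powr \<delta> \<le> measure \<mu> (ball x r \<inter> X)"
    "0 < K" "\<forall>A. A \<subseteq> X \<longrightarrow> emeasure \<mu> A \<le> ennreal K * hausdorff_content \<delta> A"
proof -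
  have \<mu>: "borel_prob_on X \<mu>" using assms(1) by (simp add: ahlfors_regular_def)
  interpret prob_space \<mu> using borel_prob_onD(1)[OF \<mu>] .
  obtain c where c: "c \<ge> 1"
    and lo: "\<And>x r. x \<in> X \<Longrightarrow> 0 < r \<Longrightarrow> r \<le> diameter X \<Longrightarrow>
        inverse c * r powr \<delta> \<le> measure \<mu> (ball x r \<inter> X)"
    and up: "\<And>x r. x \<in> X \<Longrightarrow> 0 < r \<Longrightarrow> r \<le> diameter X \<Longrightarrow>
        measure \<mu> (ball x r \<inter> X) \<le> c * r powr \<delta>"
    using assms(1) unfolding ahlfors_regular_def by blast
  \<comment> \<open>The entry \<open>c\<close> serves balls of diameter at most
    \<open>diameter X\<close>, which are recentred in \<open>X\<close> with doubled radius. The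
    other entry serves larger balls, whose measure is only known to be at most 1.\<close>
  define K where "K = max c (inverse (diameter X powr \<delta>))"
  have "emeasure \<mu> (ball y b \<inter> X) \<le> ennreal K * ball_cost \<delta> b" if b: "0 < b" for y b
  proof -
    have "measure \<mu> (ball y b \<inter> X) \<le> K * (2 * b) powr \<delta>"
    proof (cases "ball y b \<inter> X = {}")
      case True
      then show ?thesis using c by (simp add: K_def)
    next
      case False
      then obtain x where x: "x \<in> X" "dist y x < b" by auto
      show ?thesis
      proof (cases "2 * b \<le> diameter X")
        case True
        have "ball y b \<subseteq> ball x (2 * b)"
        proof
          fix v assume "v \<in> ball y b"
          then show "v \<in> ball x (2 * b)"
            using x(2) dist_triangle[of x v y] by (simp add: dist_commute)
        qed
        then have "measure \<mu> (ball y b \<inter> X) \<le> measure \<mu> (ball x (2 * b) \<inter> X)"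
          using borel_prob_on_Int_sets[OF \<mu>, of "ball x (2 * b)"] by (intro finite_measure_mono) auto
        also have "\<dots> \<le> c * (2 * b) powr \<delta>" using up[OF x(1), of "2 * b"] b True by simp
        also have "\<dots> \<le> K * (2 * b) powr \<delta>" by (intro mult_right_mono) (auto simp: K_def)
        finally show ?thesis .
      next
        case False
        have "1 = inverse (diameter X powr \<delta>) * diameter X powr \<delta>" using assms(2) by simp
        also have "\<dots> \<le> K * (2 * b) powr \<delta>"
          using False assms(2,3) c by (intro mult_mono powr_mono2) (auto simp: K_def)
        finally show ?thesis using prob_le_1 order_trans by blast
      qed
    qed
    then show ?thesis using b c
      by (simp add: emeasure_eq_measure ennreal_mult[symmetric] K_def)
  qed
  moreover have "K > 0" using c by (simp add: K_def)
  ultimately have "emeasure \<mu> A \<le> ennreal K * hausdorff_content \<delta> A" if "A \<subseteq> X" for A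
    by (intro emeasure_le_content_of_ball_bound[OF \<mu> that])
  with lo c show thesis by (intro that[of "inverse c" K]) (auto simp: K_def)
qed

text \<open>Disjoint balls of radius \<open>e\<close> centred in \<open>X\<close> each have measure
  at least \<open>e powr \<delta> / c\<close>. Hence the dilations from Vitali's lemma cover
  \<open>X\<close> at a cost of order \<open>e powr (p - \<delta>)\<close>, which tends to 0 with
  \<open>e\<close>.\<close>

lemma ahlfors_content_eq_0:
  fixes X :: "'a::euclidean_space set"
  assumes "ahlfors_regular X \<delta> \<mu>" "0 < diameter X" "\<delta> < p" "0 \<le> p"
  shows "hausdorff_content p X = 0"
proof -
  have \<mu>: "borel_prob_on X \<mu>" using assms(1) by (simp add: ahlfors_regular_def)
  interpret prob_space \<mu> using borel_prob_onD(1)[OF \<mu>] .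
  obtain c where c: "c \<ge> 1"
    and lo: "\<And>x r. x \<in> X \<Longrightarrow> 0 < r \<Longrightarrow> r \<le> diameter X \<Longrightarrow>
        inverse c * r powr \<delta> \<le> measure \<mu> (ball x r \<inter> X)"
    using assms(1) unfolding ahlfors_regular_def by blast
  have bound: "hausdorff_content p X \<le> ennreal (c * 10 powr p * e powr (p - \<delta>))"
    if e: "0 < e" "e \<le> diameter X" for e
  proof -
    have X: "X \<subseteq> (\<Union>x\<in>X. ball x e)" using e by force
    obtain C where C: "countable C" "C \<subseteq> X"
        "pairwise (\<lambda>u v. disjnt (ball u e) (ball v e)) C" "X \<subseteq> (\<Union>u\<in>C. ball u (5 * e))"
      by (rule Vitali_covering_lemma_balls[OF X, of e]) (use e in auto)
    have "hausdorff_content p X \<le> (\<integral>\<^sup>+ u. ball_cost p (5 * e) \<partial>count_space C)"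
      by (rule hausdorff_content_le_countable[OF C(1,4)])
    also have "\<dots> \<le> (\<integral>\<^sup>+ u. ennreal (c * 10 powr p * e powr (p - \<delta>)) * emeasure \<mu> (ball u e \<inter> X) \<partial>count_space C)"
    proof (rule nn_integral_mono)
      fix u assume "u \<in> space (count_space C)"
      then have u: "u \<in> X" using C(2) by auto
      have "(2 * max 0 (5 * e)) powr p = 10 powr p * e powr (p - \<delta>) * e powr \<delta>"
        using e by (simp add: powr_mult powr_add[symmetric])
      also have "\<dots> \<le> 10 powr p * e powr (p - \<delta>) * (c * measure \<mu> (ball u e \<inter> X))"
        using lo[OF u e] c by (intro mult_left_mono) (auto simp: field_simps)
      finally have "(2 * max 0 (5 * e)) powr p \<le> c * 10 powr p * e powr (p - \<delta>) * measure \<mu> (ball u e \<inter> X)"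
        by (simp only: mult_ac)
      then show "ball_cost p (5 * e) \<le> ennreal (c * 10 powr p * e powr (p - \<delta>)) * emeasure \<mu> (ball u e \<inter> X)"
        using c by (simp add: emeasure_eq_measure ennreal_mult[symmetric])
    qed
    also have "\<dots> = ennreal (c * 10 powr p * e powr (p - \<delta>)) * emeasure \<mu> (\<Union>u\<in>C. ball u e \<inter> X)"
    proof -
      have "disjoint_family_on (\<lambda>u. ball u e \<inter> X) C"
        using C(3) by (fastforce simp: disjoint_family_on_def pairwise_def disjnt_iff)
      then show ?thesis using C(1) borel_prob_on_Int_sets[OF \<mu>]
        by (simp add: nn_integral_cmult emeasure_UN_countable del: UN_simps)
    qed
    also have "\<dots> \<le> ennreal (c * 10 powr p * e powr (p - \<delta>)) * 1"
      by (intro mult_left_mono emeasure_le_1) auto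
    finally show ?thesis by simp
  qed
  have "((\<lambda>e. e powr (p - \<delta>)) \<longlongrightarrow> 0) (at_right 0)"
    using assms(3) by (intro tendsto_eq_intros tendsto_zero_powrI)
       (auto simp: eventually_at_right_less intro!: tendsto_eq_intros eventually_at_right_less[THEN eventually_mono])
  then have "((\<lambda>e. ennreal (c * 10 powr p * e powr (p - \<delta>))) \<longlongrightarrow> ennreal (c * 10 powr p * 0)) (at_right 0)"
    by (intro tendsto_ennrealI tendsto_mult tendsto_const)
  moreover have "\<forall>\<^sub>F e in at_right 0. hausdorff_content p X \<le> ennreal (c * 10 powr p * e powr (p - \<delta>))"
    using bound assms(2) by (auto simp: eventually_at_right_field intro!: exI[of _ "diameter X"])
  ultimately have "hausdorff_content p X \<le> ennreal (c * 10 powr p * 0)"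
    by (intro tendsto_lowerbound[where F="at_right 0"]) auto
  then show ?thesis by simp
qed

section \<open>Traces of sets of full measure on the copies\<close>

text \<open>The points of lower local dimension above \<open>p\<close> form a non-null set, and each
  has the decay \<open>\<rho> powr p\<close> below some scale. So for one of the countably many
  scales \<open>1 / (n + 1)\<close> the points with this decay have positive outer measure.
  Measurability of that set is not established, which is why the conclusion speaks of its measurable
  supersets \<open>T\<close>.\<close>

lemma upper_hausdorff_dim_non_null:
  fixes X :: "'a::euclidean_space set"
  assumes \<nu>: "borel_prob_on X \<nu>" and top: "upper_hausdorff_dim \<nu> \<noteq> \<infinity>"
    and p: "ereal p < upper_hausdorff_dim \<nu>"
  obtains \<rho>0 \<epsilon> :: real where "\<rho>0 > 0" "\<epsilon> > 0"
    "\<forall>T\<in>sets \<nu>. {y \<in> X. \<forall>\<rho>. 0 < \<rho> \<and> \<rho> < \<rho>0 \<longrightarrow> measure \<nu> (ball y \<rho> \<inter> X) \<le> \<rho> powr p} \<subseteq> T \<longrightarrow>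
       \<epsilon> \<le> measure \<nu> T"
proof -
  interpret prob_space \<nu> using borel_prob_onD(1)[OF \<nu>] .
  have space: "space \<nu> = X" by (rule borel_prob_onD(2)[OF \<nu>])
  define S where "S \<rho>0 = {y \<in> X. \<forall>\<rho>. 0 < \<rho> \<and> \<rho> < \<rho>0 \<longrightarrow> measure \<nu> (ball y \<rho> \<inter> X) \<le> \<rho> powr p}" for \<rho>0
  \<comment> \<open>By convention \<open>esssup\<close> of a non-measurable function is
    \<open>\<infinity>\<close>, so \<open>top\<close> yields measurability.\<close>
  have meas: "lower_local_dim \<nu> \<in> borel_measurable \<nu>"
    using top esssup_non_measurable[of "lower_local_dim \<nu>" \<nu>]
    by (auto simp: upper_hausdorff_dim_def top_ereal_def)
  have ex: "\<exists>n. y \<in> S (inverse (real (Suc n)))" if y: "y \<in> X" "ereal p < lower_local_dim \<nu> y" for y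
  proof -
    have "\<forall>\<^sub>F r in at_right 0. ereal p < (if measure \<nu> (ball y r \<inter> space \<nu>) = 0 then \<infinity>
         else ereal (ln (measure \<nu> (ball y r \<inter> space \<nu>)) / ln r))"
      using y(2) unfolding lower_local_dim_def by (rule less_LiminfD)
    then obtain r0 where r0: "r0 > 0" and *: "\<And>r. 0 < r \<Longrightarrow> r < r0 \<Longrightarrow>
        measure \<nu> (ball y r \<inter> X) \<noteq> 0 \<Longrightarrow> p < ln (measure \<nu> (ball y r \<inter> X)) / ln r"
      unfolding eventually_at_right_field space by (auto split: if_splits)
    obtain n where n: "inverse (real (Suc n)) < r0"
      using reals_Archimedean[OF r0] by auto
    have "measure \<nu> (ball y r \<inter> X) \<le> r powr p"
      if r: "0 < r" "r < inverse (real (Suc n))" for r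
    proof (cases "measure \<nu> (ball y r \<inter> X) = 0")
      case False
      have "inverse (real (Suc n)) \<le> 1" by (simp add: inverse_le_1_iff)
      then have "ln r < 0" using r by (subst ln_less_zero_iff) auto
      then have "ln (measure \<nu> (ball y r \<inter> X)) < p * ln r"
        using *[of r] False r n by (simp add: field_simps)
      moreover have "measure \<nu> (ball y r \<inter> X) > 0" using False by (simp add: less_le)
      ultimately show ?thesis using r
        by (metis less_imp_le ln_powr ln_less_cancel_iff powr_gt_zero less_numeral_extra(3) not_less)
    qed simp
    then show ?thesis using y(1) by (auto simp: S_def)
  qed
  have "\<exists>n. outer_measure_of \<nu> (S (inverse (real (Suc n)))) \<noteq> 0"
  proof (rule ccontr)
    assume "\<not> ?thesis"
    then have "\<forall>n. \<exists>N\<in>sets \<nu>. S (inverse (real (Suc n))) \<subseteq> N \<and> emeasure \<nu> N = 0"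
      using outer_measure_of_attain[of "S (inverse (real (Suc _)))" \<nu>]
      by (metis (no_types, lifting) S_def mem_Collect_eq space subsetI)
    then obtain N where N: "\<And>n. N n \<in> sets \<nu>" "\<And>n. S (inverse (real (Suc n))) \<subseteq> N n"
        "\<And>n. emeasure \<nu> (N n) = 0"
      by metis
    have "(\<Union>n. N n) \<in> null_sets \<nu>" using N by (intro null_sets_UN) auto
    moreover have "{x \<in> space \<nu>. lower_local_dim \<nu> x > p} \<subseteq> (\<Union>n. N n)"
      using ex N(2) space by blast
    ultimately have "emeasure \<nu> {x \<in> space \<nu>. lower_local_dim \<nu> x > p} = 0"
      by (metis (no_types, lifting) emeasure_mono le_zero_eq null_setsD1 null_setsD2)
    then show False
      using esssup_pos_measure[OF meas p[unfolded upper_hausdorff_dim_def]] by simp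
  qed
  then obtain n where n: "outer_measure_of \<nu> (S (inverse (real (Suc n)))) \<noteq> 0" by blast
  let ?S = "S (inverse (real (Suc n)))"
  have "outer_measure_of \<nu> ?S \<le> outer_measure_of \<nu> (space \<nu>)"
    by (rule outer_measure_of_mono) (auto simp: S_def space)
  then have fin: "outer_measure_of \<nu> ?S \<le> 1" by (simp add: emeasure_space_1)
  show thesis
  proof (rule that[of "inverse (real (Suc n))" "enn2real (outer_measure_of \<nu> ?S)"])
    show "0 < enn2real (outer_measure_of \<nu> ?S)"
      using n fin by (auto simp: enn2real_positive_iff less_top[symmetric] zero_less_iff_neq_zero top_unique)
    show "\<forall>T\<in>sets \<nu>. {y \<in> X. \<forall>\<rho>. 0 < \<rho> \<and> \<rho> < inverse (real (Suc n)) \<longrightarrow>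
        measure \<nu> (ball y \<rho> \<inter> X) \<le> \<rho> powr p} \<subseteq> T \<longrightarrow> enn2real (outer_measure_of \<nu> ?S) \<le> measure \<nu> T"
    proof (intro ballI impI)
      fix T assume T: "T \<in> sets \<nu>"
        "{y \<in> X. \<forall>\<rho>. 0 < \<rho> \<and> \<rho> < inverse (real (Suc n)) \<longrightarrow> measure \<nu> (ball y \<rho> \<inter> X) \<le> \<rho> powr p} \<subseteq> T"
      then have "outer_measure_of \<nu> ?S \<le> emeasure \<nu> T"
        using outer_measure_of_mono[of ?S T \<nu>] by (simp add: S_def)
      then show "enn2real (outer_measure_of \<nu> ?S) \<le> measure \<nu> T"
        unfolding measure_def by (intro enn2real_mono) (auto simp: emeasure_eq_measure)
    qed
  qed simp
qed

text \<open>A cover of \<open>F n \<inter> L\<close> is transported to \<open>X\<close> by the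
  quasi-self-conformal map. The images miss only a null set: its preimage lies outside
  \<open>L\<close>, and the lower measure comparison carries nullity from \<open>F n\<close> to
  \<open>X\<close>. So the images that meet the set \<open>S\<close> of points with decay have total
  mass at least \<open>\<epsilon>\<close>, while each has mass at most a constant times
  \<open>(b m / d) powr p\<close>.\<close>

lemma quasi_self_conformal_content_bound:
  fixes X :: "'a::euclidean_space set" and F :: "nat \<Rightarrow> 'a set"
  assumes X: "compact X" "0 < diameter X" and \<nu>: "borel_prob_on X \<nu>"
    and F: "\<And>n. F n \<subseteq> X" "\<And>n. closed (F n)" and qsc: "quasi_self_conformal X \<nu> F"
    and top: "upper_hausdorff_dim \<nu> \<noteq> \<infinity>" and p: "0 \<le> p" "ereal p < upper_hausdorff_dim \<nu>"
  obtains \<kappa> where "\<kappa> > 0" "\<forall>n. 0 < diameter (F n)"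
    "\<forall>n L. measure \<nu> L = 1 \<longrightarrow> ennreal (\<kappa> * diameter (F n) powr p) \<le> hausdorff_content p (F n \<inter> L)"
proof -
  interpret prob_space \<nu> using borel_prob_onD(1)[OF \<nu>] .
  have space: "space \<nu> = X" by (rule borel_prob_onD(2)[OF \<nu>])
  obtain \<rho>0 \<epsilon> :: real where \<rho>0: "\<rho>0 > 0" and \<epsilon>: "\<epsilon> > 0" and nonnull:
    "\<forall>T\<in>sets \<nu>. {y \<in> X. \<forall>\<rho>. 0 < \<rho> \<and> \<rho> < \<rho>0 \<longrightarrow> measure \<nu> (ball y \<rho> \<inter> X) \<le> \<rho> powr p} \<subseteq> T \<longrightarrow>
       \<epsilon> \<le> measure \<nu> T"
    by (rule upper_hausdorff_dim_non_null[OF \<nu> top p(2)])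
  define S where "S = {y \<in> X. \<forall>\<rho>. 0 < \<rho> \<and> \<rho> < \<rho>0 \<longrightarrow> measure \<nu> (ball y \<rho> \<inter> X) \<le> \<rho> powr p}"
  obtain C where C: "C \<ge> 1" and fs: "\<And>n. \<exists>f. bij_betw f (F n) X \<and>
        (\<forall>x\<in>F n. \<forall>y\<in>F n.
           inverse C * (dist x y / diameter (F n)) \<le> dist (f x) (f y) \<and>
           dist (f x) (f y) \<le> C * (dist x y / diameter (F n))) \<and>
        (\<forall>A\<in>sets \<nu>.
           inverse C * measure \<nu> A \<le> measure \<nu> (f -` A \<inter> F n) / measure \<nu> (F n) \<and>
           measure \<nu> (f -` A \<inter> F n) / measure \<nu> (F n) \<le> C * measure \<nu> A)"
    using qsc unfolding quasi_self_conformal_def by blast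
  \<comment> \<open>The minimum serves two cases: if \<open>\<rho>0 \<le> 3 * C * b m / d\<close>
    for some ball, this ball alone costs enough; otherwise the decay holds for all image balls and
    \<open>\<epsilon>\<close> counts. The factor \<open>2 / (3 * C)\<close> converts the image
    radius back into the diameter \<open>2 * b m\<close>.\<close>
  define \<kappa> where "\<kappa> = min \<epsilon> (\<rho>0 powr p) * (2 / (3 * C)) powr p"
  have cF: "compact (F n)" for n using X(1) F compact_Int_closed[of X "F n"] by (simp add: inf.absorb2)
  have dpos: "0 < diameter (F n)" for n
  proof -
    obtain f where f: "bij_betw f (F n) X" using fs by blast
    obtain x y where "x \<in> X" "y \<in> X" "x \<noteq> y"
      using X(2) by (metis diameter_empty diameter_singleton is_singletonI' is_singleton_the_elem less_irrefl)
    then obtain u v where "u \<in> F n" "v \<in> F n" "u \<noteq> v" using f by (metis bij_betw_def imageE)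
    then show ?thesis
      using diameter_bounded_bound[of "F n" u v] cF[of n] compact_imp_bounded
      by (metis less_le_trans zero_less_dist_iff)
  qed
  have "ennreal (\<kappa> * diameter (F n) powr p) \<le> hausdorff_content p (F n \<inter> L)"
    if L1: "measure \<nu> L = 1" for n L
  proof -
    define d where "d = diameter (F n)"
    have d: "d > 0" using dpos by (simp add: d_def)
    have L: "L \<in> sets \<nu>" using L1 measure_notin_sets by fastforce
    obtain f where f: "bij_betw f (F n) X"
      and fup: "\<And>x y. x \<in> F n \<Longrightarrow> y \<in> F n \<Longrightarrow> dist (f x) (f y) \<le> C * (dist x y / d)"
      and flo: "\<And>A. A \<in> sets \<nu> \<Longrightarrow> inverse C * measure \<nu> A \<le> measure \<nu> (f -` A \<inter> F n) / measure \<nu> (F n)"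
      using fs[of n] unfolding d_def by blast
    have "(C / d)-lipschitz_on (F n) f"
      using fup C d by (intro lipschitz_onI) auto
    then have cont: "continuous_on (F n) f" by (rule lipschitz_on_continuous_on)
    have bound: "ennreal (\<kappa> * d powr p) \<le> (\<Sum>i. ball_cost p (b i))"
      if cov: "F n \<inter> L \<subseteq> (\<Union>i. ball (a i) (b i))" for a :: "nat \<Rightarrow> 'a" and b :: "nat \<Rightarrow> real"
    proof (cases "\<exists>m. 0 < b m \<and> \<rho>0 \<le> 3 * C * b m / d")
      case True
      then obtain m where m: "0 < b m" "\<rho>0 \<le> 3 * C * b m / d" by blast
      have "\<kappa> * d powr p \<le> \<rho>0 powr p * ((2 / (3 * C)) powr p * d powr p)"
        unfolding \<kappa>_def mult.assoc by (intro mult_right_mono) auto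
      also have "\<dots> \<le> (3 * C * b m / d) powr p * ((2 / (3 * C)) powr p * d powr p)"
        using m \<rho>0 p by (intro mult_right_mono powr_mono2) auto
      also have "\<dots> = (2 * max 0 (b m)) powr p"
        using m C d by (simp add: powr_mult[symmetric])
      finally have "ennreal (\<kappa> * d powr p) \<le> ball_cost p (b m)" by (rule ennreal_leI)
      also have "\<dots> \<le> (\<Sum>i. ball_cost p (b i))"
        using sum_le_suminf[OF summableI, of "{m}" "\<lambda>i. ball_cost p (b i)"]
        by (simp only: sum.insert sum.empty finite.intros insert_absorb empty_iff not_False_eq_True add_0_right zero_le simp_thms)
      finally show ?thesis .
    next
      case False
      then have small: "3 * C * b m / d < \<rho>0" if "0 < b m" for m using that by force
      \<comment> \<open>Closed balls have compact images under the Lipschitz map, hence measurable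
        ones. Radius 0 must be excluded, since the closed ball is then a point although the open
        ball is empty.\<close>
      define T where "T m = (if 0 < b m then f ` (F n \<inter> cball (a m) (b m)) else {})" for m
      have Tsub: "T m \<subseteq> X" for m using f by (auto simp: T_def bij_betw_def)
      have "compact (T m)" for m
        unfolding T_def using cF[of n] cont
        by (auto intro!: compact_continuous_image compact_Int_closed elim: continuous_on_subset)
      then have Tm: "T m \<in> sets \<nu>" for m
        using borel_prob_on_Int_sets[OF \<nu>, of "T m"] Tsub[of m]
        by (simp add: inf.absorb1 borel_compact)
      have "f -` (X - (\<Union>m. T m)) \<inter> F n \<subseteq> X - L"
      proof
        fix u assume u: "u \<in> f -` (X - (\<Union>m. T m)) \<inter> F n"
        have "u \<notin> L"
        proof
          assume "u \<in> L"
          then obtain m where "u \<in> ball (a m) (b m)" using cov u by blast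
          then have "f u \<in> T m" using u unfolding T_def
            by (auto simp: dist_commute intro!: imageI dest: le_less_trans[OF zero_le_dist])
          then show False using u by blast
        qed
        then show "u \<in> X - L" using u F by blast
      qed
      moreover have "measure \<nu> (X - L) = 0"
        using prob_compl[OF L] L1 space by simp
      ultimately have z: "measure \<nu> (f -` (X - (\<Union>m. T m)) \<inter> F n) = 0"
        using L space by (metis (no_types, lifting) finite_measure_mono measure_le_0_iff sets.compl_sets)
      have UT: "X - (\<Union>m. T m) \<in> sets \<nu>"
        using Tm space by (metis sets.compl_sets sets.countable_UN image_subset_iff)
      have z2: "measure \<nu> (X - (\<Union>m. T m)) = 0"
      proof -
        have "inverse C * measure \<nu> (X - (\<Union>m. T m)) \<le> 0" using flo[OF UT] z by simp
        then show ?thesis using C measure_nonneg[of \<nu> "X - (\<Union>m. T m)"]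
          by (simp add: mult_le_0_iff measure_le_0_iff)
      qed
      \<comment> \<open>The decay is known only around points of \<open>S\<close>, so images that
        miss \<open>S\<close> are dropped; the others still cover \<open>S\<close> up to the null
        set.\<close>
      define T' where "T' m = (if T m \<inter> S \<noteq> {} then T m else {})" for m
      have T'm: "range T' \<subseteq> sets \<nu>" using Tm by (auto simp: T'_def)
      have T'le: "emeasure \<nu> (T' m) \<le> ennreal ((3 * C / (2 * d)) powr p) * ball_cost p (b m)" for m
      proof (cases "T m \<inter> S = {}")
        case False
        then obtain y where y: "y \<in> T m" "y \<in> S" by blast
        then have bm: "b m > 0" by (auto simp: T_def split: if_splits)
        obtain v where v: "v \<in> F n" "dist (a m) v \<le> b m" "y = f v"
          using y(1) bm by (auto simp: T_def)
        \<comment> \<open>Two points of the closed ball are at most \<open>2 * b m\<close> apart;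
          the factor 3 leaves room for the strict inequality of an open ball.\<close>
        have "T m \<subseteq> ball y (3 * C * b m / d) \<inter> X"
        proof
          fix w assume w: "w \<in> T m"
          then obtain u where u: "u \<in> F n" "dist (a m) u \<le> b m" "w = f u"
            using bm by (auto simp: T_def)
          have "dist v u \<le> 2 * b m"
            using u(2) v(2) dist_triangle2[of v u "a m"] by (simp add: dist_commute)
          then have "C * (dist v u / d) \<le> C * (2 * b m / d)"
            using C d by (intro mult_left_mono divide_right_mono) auto
          also have "\<dots> < 3 * C * b m / d" using C d bm by (simp add: field_simps)
          finally show "w \<in> ball y (3 * C * b m / d) \<inter> X"
            using fup[OF v(1) u(1)] u(3) v(3) w Tsub[of m] by auto
        qed
        then have "measure \<nu> (T m) \<le> measure \<nu> (ball y (3 * C * b m / d) \<inter> X)"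
          by (intro finite_measure_mono borel_prob_on_Int_sets[OF \<nu>]) auto
        also have "\<dots> \<le> (3 * C * b m / d) powr p"
          using y(2) small[OF bm] bm C d by (simp add: S_def)
        also have "\<dots> = (3 * C / (2 * d)) powr p * (2 * max 0 (b m)) powr p"
          using bm C d by (simp add: powr_mult[symmetric] mult.assoc)
        finally show ?thesis using False
          by (simp add: T'_def emeasure_eq_measure ennreal_mult[symmetric])
      qed (simp add: T'_def)
      have sub: "S \<subseteq> (X - (\<Union>m. T m)) \<union> (\<Union>m. T' m)"
        by (auto simp: T'_def S_def)
      have "ennreal \<epsilon> \<le> emeasure \<nu> ((X - (\<Union>m. T m)) \<union> (\<Union>m. T' m))"
        using nonnull[rule_format, OF _ sub[unfolded S_def]] UT sets.countable_nat_UN[OF T'm]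
        by (simp add: emeasure_eq_measure sets.Un)
      also have "\<dots> \<le> emeasure \<nu> (X - (\<Union>m. T m)) + emeasure \<nu> (\<Union>m. T' m)"
        using UT sets.countable_nat_UN[OF T'm] by (rule emeasure_subadditive)
      also have "\<dots> = emeasure \<nu> (\<Union>m. T' m)" using z2 by (simp add: emeasure_eq_measure)
      also have "\<dots> \<le> (\<Sum>m. emeasure \<nu> (T' m))" by (rule emeasure_subadditive_countably[OF T'm])
      also have "\<dots> \<le> (\<Sum>m. ennreal ((3 * C / (2 * d)) powr p) * ball_cost p (b m))"
        by (intro suminf_le summableI T'le)
      finally have "ennreal \<epsilon> \<le> ennreal ((3 * C / (2 * d)) powr p) * (\<Sum>m. ball_cost p (b m))" by simp
      then have "ennreal ((2 * d / (3 * C)) powr p) * ennreal \<epsilon> \<le>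
          ennreal ((2 * d / (3 * C)) powr p) * (ennreal ((3 * C / (2 * d)) powr p) * (\<Sum>m. ball_cost p (b m)))"
        by (rule mult_left_mono) simp
      also have "\<dots> = ennreal ((2 * d / (3 * C)) powr p * (3 * C / (2 * d)) powr p) * (\<Sum>m. ball_cost p (b m))"
        by (simp add: ennreal_mult mult.assoc)
      also have "(2 * d / (3 * C)) powr p * (3 * C / (2 * d)) powr p = 1"
        using C d by (simp add: powr_mult[symmetric])
      finally have "ennreal ((2 * d / (3 * C)) powr p * \<epsilon>) \<le> (\<Sum>m. ball_cost p (b m))"
        using \<epsilon> by (simp add: ennreal_mult)
      moreover have "\<kappa> * d powr p \<le> (2 * d / (3 * C)) powr p * \<epsilon>"
      proof -
        have "\<kappa> * d powr p \<le> \<epsilon> * ((2 / (3 * C)) powr p * d powr p)"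
          unfolding \<kappa>_def mult.assoc by (intro mult_right_mono) auto
        also have "\<dots> = (2 * d / (3 * C)) powr p * \<epsilon>"
          using C d by (simp add: powr_mult[symmetric])
        finally show ?thesis .
      qed
      ultimately show ?thesis using ennreal_leI order_trans by blast
    qed
    show ?thesis
      unfolding hausdorff_content_eq d_def[symmetric] by (intro INF_greatest) (use bound in auto)
  qed
  moreover have "\<kappa> > 0" using \<epsilon> \<rho>0 C by (simp add: \<kappa>_def)
  ultimately show thesis using that dpos by blast
qed

section \<open>The three applications of the Vitali estimate\<close>

text \<open>Vitali at exponent \<open>s\<close>: cover balls of diameter at most \<open>r\<close>
  and heavy balls inside \<open>E\<close> both trade \<open>s\<close> for \<open>t\<close> at the
  price \<open>r powr (s - t)\<close>. Cancelling this factor against the content bound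
  \<open>c * r powr D\<close> leaves \<open>r powr p\<close>. A cover ball of diameter at least
  \<open>r\<close> has by itself mass at least \<open>r powr t\<close>, hence at least
  \<open>r powr p\<close> as \<open>r \<le> 1\<close>; this case accounts for the 1 in the
  maximum.\<close>

lemma open_subset_ball_cost_bound:
  fixes E X :: "'a::euclidean_space set" and W :: "nat measure"
  assumes W: "sets W = UNIV" "\<And>i. emeasure W {i} = ball_cost t (\<rho> i)"
    and t: "0 < t" "t < s" and c: "0 < c" "0 < c1" and r: "0 < r" "r \<le> 1" and p: "t \<le> p" "p = D - (s - t)"
    and E: "openin (top_of_set X) E" "E \<subseteq> ball x r"
    and content: "ennreal (c * r powr D) \<le> hausdorff_content s E"
    and crowded: "\<And>u q. u \<in> X \<Longrightarrow> 0 < q \<Longrightarrow> cball u q \<subseteq> ball x r \<Longrightarrow> cball u q \<inter> X \<subseteq> E \<Longrightarrow>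
       ennreal (c1 * q powr t) \<le> emeasure W (hits y \<rho> (ball u q))"
  shows "ennreal (r powr p) \<le>
    ennreal (max 1 ((5 powr s + 20 powr s / c1) / c)) * emeasure W (hits y \<rho> (ball x r))"
proof (cases "emeasure W (hits y \<rho> (ball x r))")
  case top
  then show ?thesis by (simp add: ennreal_mult_top)
next
  case (real w)
  let ?I = "hits y \<rho> (ball x r)"
  define K where "K = max 1 ((5 powr s + 20 powr s / c1) / c)"
  have "r powr p \<le> K * w"
  proof (cases "\<exists>i\<in>?I. r \<le> 2 * \<rho> i")
    case True
    then obtain i where i: "i \<in> ?I" "r \<le> 2 * \<rho> i" by blast
    have "r powr p \<le> r powr t" using r p by (intro powr_mono') auto
    also have "\<dots> \<le> (2 * max 0 (\<rho> i)) powr t" using i r t by (intro powr_mono2) auto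
    also have "\<dots> \<le> w"
    proof -
      have "emeasure W {i} \<le> emeasure W ?I" using i W by (intro emeasure_mono) auto
      then show ?thesis using W(2) real by (simp add: ennreal_le_iff)
    qed
    also have "\<dots> \<le> K * w"
      using mult_right_mono[of 1 K w] real by (simp add: K_def)
    finally show ?thesis .
  next
    case False
    have "hausdorff_content s E \<le> (ennreal (5 powr s * r powr (s - t)) + ennreal (20 powr s) * ennreal (r powr (s - t) / c1))
        * emeasure W ?I"
    proof (rule vitali_content_bound[where b = r, OF W(1)])
      show "0 \<le> s" using t by simp
    next
      fix i assume i: "i \<in> ?I"
      then have \<rho>: "0 < \<rho> i" "2 * \<rho> i \<le> r" using hits_ballD[OF i] False by force+
      have "(2 * (5 * \<rho> i)) powr s = 5 powr s * ((2 * \<rho> i) powr (s - t) * (2 * \<rho> i) powr t)"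
        using \<rho> by (simp add: powr_mult[symmetric] powr_add[symmetric])
      also have "\<dots> \<le> 5 powr s * (r powr (s - t) * (2 * \<rho> i) powr t)"
        using \<rho> t by (intro mult_left_mono mult_right_mono powr_mono2) auto
      finally have "(2 * max 0 (5 * \<rho> i)) powr s \<le> 5 powr s * r powr (s - t) * (2 * max 0 (\<rho> i)) powr t"
        using \<rho> by (simp add: mult.assoc)
      then show "ball_cost s (5 * \<rho> i) \<le> ennreal (5 powr s * r powr (s - t)) * emeasure W {i}"
        unfolding W(2) by (simp add: ennreal_mult[symmetric])
    next
      fix u assume u: "u \<in> E"
      obtain U where U: "open U" "E = X \<inter> U" using E(1) by (auto simp: openin_open)
      have "open (U \<inter> ball x r)" "u \<in> U \<inter> ball x r" using U u E by auto
      then obtain q where q: "0 < q" "cball u q \<subseteq> U \<inter> ball x r"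
        by (metis open_contains_cball_eq)
      have "q \<le> r"
      proof -
        have "cball u q \<subseteq> cball x r" using q(2) by force
        then show ?thesis using q(1) r by (simp add: cball_subset_cball_iff) (smt (verit) zero_le_dist)
      qed
      have "ennreal (c1 * q powr t) \<le> emeasure W (hits y \<rho> (ball u q))"
        using q u U by (intro crowded) auto
      have sub: "hits y \<rho> (ball u q) \<subseteq> ?I"
        using q(2) by (intro hits_mono) force
      have "ennreal (q powr s) \<le> ennreal (r powr (s - t) / c1) * ennreal (c1 * q powr t)"
      proof -
        have "q powr s = q powr (s - t) * q powr t" by (simp add: powr_add[symmetric])
        also have "\<dots> \<le> r powr (s - t) * q powr t"
          using q \<open>q \<le> r\<close> t by (intro mult_right_mono powr_mono2) auto
        finally show ?thesis using c by (simp add: ennreal_mult[symmetric])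
      qed
      also have "\<dots> \<le> ennreal (r powr (s - t) / c1) * emeasure W (hits y \<rho> (ball u q))"
        by (intro mult_left_mono) (use \<open>ennreal (c1 * q powr t) \<le> _\<close> in auto)
      finally show "\<exists>q. 0 < q \<and> q \<le> r \<and> hits y \<rho> (ball u q) \<subseteq> ?I \<and>
          ennreal (q powr s) \<le> ennreal (r powr (s - t) / c1) * emeasure W (hits y \<rho> (ball u q))"
        using q \<open>q \<le> r\<close> sub by blast
    qed
    also have "\<dots> = ennreal ((5 powr s * r powr (s - t) + 20 powr s * (r powr (s - t) / c1)) * w)"
      using c real by (simp add: ennreal_mult[symmetric] ennreal_plus[symmetric] del: ennreal_plus)
    finally have "ennreal (c * r powr D) \<le> ennreal ((5 powr s * r powr (s - t) + 20 powr s * (r powr (s - t) / c1)) * w)"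
      using content order_trans by blast
    then have le: "c * r powr D \<le> (5 powr s * r powr (s - t) + 20 powr s * (r powr (s - t) / c1)) * w"
      using c real by (subst (asm) ennreal_le_iff) auto
    have "r powr (s - t) * (c * r powr p) = c * r powr D"
      using p by (simp add: powr_add[symmetric])
    also have "\<dots> \<le> r powr (s - t) * ((5 powr s + 20 powr s / c1) * w)"
      using le by (simp add: algebra_simps)
    finally have "c * r powr p \<le> (5 powr s + 20 powr s / c1) * w"
      using r by simp
    then have "r powr p \<le> (5 powr s + 20 powr s / c1) / c * w"
      using c by (simp add: field_simps)
    also have "\<dots> \<le> K * w" using real by (intro mult_right_mono) (auto simp: K_def)
    finally show ?thesis .
  qed
  then show ?thesis
    using real by (simp add: K_def[symmetric] ennreal_mult[symmetric] ennreal_leI)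
       (metis K_def ennreal_leI ennreal_mult' max.coboundedI1 zero_le_one)
qed

text \<open>Vitali at exponent \<open>p\<close>: a point of the limsup lies in arbitrarily small
  balls \<open>ball (x n) (r n)\<close> with \<open>N \<le> n\<close>, to which \<open>est\<close>
  applies. Recentring at the point doubles the radius and brings in \<open>2 powr p\<close>. The
  cover balls involved have diameter at most 1, so raising the exponent from \<open>t\<close> to
  \<open>p\<close> does not increase their cost.\<close>

lemma copy_cost_bound:
  fixes F X :: "'a::euclidean_space set" and W :: "nat measure"
  assumes W: "sets W = UNIV" "\<And>i. emeasure W {i} = ball_cost t (\<rho> i)"
    and t: "0 < t" "t \<le> p" and K: "0 \<le> K"
    and F: "bounded F" "w \<in> F" "0 < diameter F"
    and small: "\<And>i. i \<in> hits y \<rho> (ball w (2 * diameter F)) \<Longrightarrow> 2 * \<rho> i \<le> 1"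
    and r: "r \<longlonglongrightarrow> 0" "\<And>n. 0 < r n"
    and est: "\<And>n. N \<le> n \<Longrightarrow> r n \<le> R \<Longrightarrow> ball (x n) (r n) \<subseteq> ball w (2 * diameter F) \<Longrightarrow>
      ennreal (r n powr p) \<le> ennreal K * emeasure W (hits y \<rho> (ball (x n) (r n)))"
    and R: "0 < R"
  shows "hausdorff_content p (F \<inter> limsup (\<lambda>n. ball (x n) (r n) \<inter> X))
     \<le> ennreal (5 powr p + 20 powr p * (2 powr p * K)) * emeasure W (hits y \<rho> (ball w (2 * diameter F)))"
proof -
  let ?d = "diameter F" and ?L = "limsup (\<lambda>n. ball (x n) (r n) \<inter> X)"
  let ?I = "hits y \<rho> (ball w (2 * ?d))"
  have "hausdorff_content p (F \<inter> ?L)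
      \<le> (ennreal (5 powr p) + ennreal (20 powr p) * ennreal (2 powr p * K)) * emeasure W ?I"
  proof (rule vitali_content_bound[where b = ?d, OF W(1)])
    show "0 \<le> p" using t by simp
  next
    fix i assume i: "i \<in> ?I"
    have \<rho>: "0 < \<rho> i" "2 * \<rho> i \<le> 1" using hits_ballD[OF i] small[OF i] by auto
    have "(2 * (5 * \<rho> i)) powr p = 5 powr p * (2 * \<rho> i) powr p"
      using \<rho> by (simp add: powr_mult[symmetric])
    also have "\<dots> \<le> 5 powr p * (2 * \<rho> i) powr t"
      using \<rho> t by (intro mult_left_mono powr_mono') auto
    finally show "ball_cost p (5 * \<rho> i) \<le> ennreal (5 powr p) * emeasure W {i}"
      unfolding W(2) using \<rho> by (simp add: ennreal_mult[symmetric])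
  next
    fix v assume v: "v \<in> F \<inter> ?L"
    have freq: "\<exists>\<^sub>F n in sequentially. v \<in> ball (x n) (r n) \<inter> X"
      using v by (simp add: mem_limsup_iff)
    \<comment> \<open>Below half the diameter of \<open>F\<close>, the recentred ball of radius
      \<open>2 * r n\<close> stays inside \<open>ball w (2 * diameter F)\<close>.\<close>
    have "\<forall>\<^sub>F n in sequentially. r n < min R (?d / 2)"
      using r(1) R F(3) by (intro order_tendstoD) auto
    then have "\<exists>\<^sub>F n in sequentially. v \<in> ball (x n) (r n) \<inter> X \<and> r n < min R (?d / 2) \<and> N \<le> n"
      by (intro frequently_eventually_frequently[OF freq] eventually_conj eventually_ge_at_top)
    then obtain n where n: "v \<in> ball (x n) (r n)" "r n < R" "2 * r n < ?d" "N \<le> n"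
      by (auto dest!: frequently_ex)
    have "dist w v \<le> ?d" using F v by (intro diameter_bounded_bound) auto
    have sub1: "ball v (2 * r n) \<subseteq> ball w (2 * ?d)"
    proof
      fix a assume "a \<in> ball v (2 * r n)"
      then show "a \<in> ball w (2 * ?d)"
        using \<open>dist w v \<le> ?d\<close> n(3) dist_triangle[of w a v] by simp
    qed
    have sub2: "ball (x n) (r n) \<subseteq> ball v (2 * r n)"
    proof
      fix a assume "a \<in> ball (x n) (r n)"
      then show "a \<in> ball v (2 * r n)"
        using n(1) dist_triangle[of v a "x n"] by (simp add: dist_commute)
    qed
    have "ennreal ((2 * r n) powr p) = ennreal (2 powr p) * ennreal (r n powr p)"
      using r(2)[of n] by (simp add: powr_mult ennreal_mult[symmetric])
    also have "\<dots> \<le> ennreal (2 powr p) * (ennreal K * emeasure W (hits y \<rho> (ball (x n) (r n))))"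
      using sub1 sub2 n by (intro mult_left_mono est) auto
    also have "\<dots> \<le> ennreal (2 powr p) * (ennreal K * emeasure W (hits y \<rho> (ball v (2 * r n))))"
      using sub2 W(1) by (intro mult_left_mono emeasure_mono hits_mono) auto
    finally have "ennreal ((2 * r n) powr p) \<le> ennreal (2 powr p * K) * emeasure W (hits y \<rho> (ball v (2 * r n)))"
      using K by (simp add: ennreal_mult mult.assoc)
    then show "\<exists>q. 0 < q \<and> q \<le> ?d \<and> hits y \<rho> (ball v q) \<subseteq> ?I \<and>
        ennreal (q powr p) \<le> ennreal (2 powr p * K) * emeasure W (hits y \<rho> (ball v q))"
      using r(2)[of n] n(3) hits_mono[OF sub1, of y \<rho>] by (intro exI[of _ "2 * r n"]) simp
  qed
  also have "ennreal (5 powr p) + ennreal (20 powr p) * ennreal (2 powr p * K)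
      = ennreal (5 powr p + 20 powr p * (2 powr p * K))"
    using K by (simp add: ennreal_mult ennreal_plus)
  finally show ?thesis .
qed

text \<open>Vitali at exponent \<open>\<delta>\<close>, applied to the part of
  \<open>limsup F\<close> in the half ball, which has the full measure of that half ball. Away from
  the cover balls, small copies \<open>F n\<close> supply mass of order
  \<open>diameter (F n) powr p\<close>, and the surplus \<open>\<delta> - p\<close> makes their
  share of the bound smaller than that of the cover balls. Lightness then leaves too little content
  for lower regularity at radius \<open>r / 2\<close>.\<close>

lemma vitali_family_contradiction:
  fixes F :: "nat \<Rightarrow> 'a::euclidean_space set" and W :: "nat measure"
  assumes W: "sets W = UNIV" "\<And>i. emeasure W {i} = ball_cost t (\<rho> i)"
    and t: "0 < t" "t \<le> p" "p < \<delta>" and \<kappa>: "0 < \<kappa>"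
    and \<mu>: "borel_prob_on X \<mu>" "measure \<mu> (limsup F) = 1"
    and k: "0 < k" "k * (r / 2) powr \<delta> \<le> measure \<mu> (ball z (r / 2) \<inter> X)"
    and K: "0 < K" "\<And>A. A \<subseteq> X \<Longrightarrow> emeasure \<mu> A \<le> ennreal K * hausdorff_content \<delta> A"
    and F: "(\<lambda>n. diameter (F n)) \<longlonglongrightarrow> 0" "\<And>n. 0 < diameter (F n)"
    and r: "0 < r" and c1: "0 < c1" "c1 \<le> 1" "c1 \<le> k / (4 * K * 10 powr \<delta>)"
    and light: "emeasure W (hits y \<rho> (ball z r)) < ennreal (c1 * r powr t)"
    and scale: "\<And>w n. w \<in> F n \<Longrightarrow> ball w (2 * diameter (F n)) \<subseteq> ball z r \<Longrightarrow> diameter (F n) \<le> 1 \<Longrightarrow>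
       (\<And>i. i \<in> hits y \<rho> (ball w (2 * diameter (F n))) \<Longrightarrow> 2 * \<rho> i \<le> diameter (F n)) \<Longrightarrow>
       ennreal (\<kappa> * diameter (F n) powr p) \<le> emeasure W (hits y \<rho> (ball w (2 * diameter (F n))))"
  shows False
proof -
  interpret prob_space \<mu> using borel_prob_onD(1)[OF \<mu>(1)] .
  let ?I = "hits y \<rho> (ball z r)"
  obtain w where w: "emeasure W ?I = ennreal w" "0 \<le> w"
    using light by (cases "emeasure W ?I") (auto simp: less_top[symmetric])
  have wlt: "w < c1 * r powr t" using light w by (simp add: ennreal_less_iff)
  define A where "A = ball z (r / 2) \<inter> X \<inter> limsup F"
  have "limsup F \<in> sets \<mu>" using \<mu>(2) measure_notin_sets by fastforce
  then have "AE u in \<mu>. u \<in> limsup F" using \<mu>(2) by (simp add: AE_in_set_eq_1)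
  then have "measure \<mu> A = measure \<mu> (ball z (r / 2) \<inter> X)"
    unfolding A_def using borel_prob_on_Int_sets[OF \<mu>(1), of "ball z (r / 2)"] \<open>limsup F \<in> sets \<mu>\<close>
    by (intro finite_measure_eq_AE) auto
  then have A: "k * (r / 2) powr \<delta> \<le> measure \<mu> A" using k by simp
  define M where "M = 5 powr \<delta> * r powr (\<delta> - t)"
  have M: "M > 0" using r by (simp add: M_def)
  \<comment> \<open>The copies \<open>F n\<close> are used only below a scale \<open>\<eta>\<close> at which the gap \<open>p < \<delta>\<close> absorbs all constants.\<close>
  have "((\<lambda>e. 20 powr \<delta> * (2 powr \<delta> * e powr (\<delta> - p) / \<kappa>)) \<longlongrightarrow> 20 powr \<delta> * (2 powr \<delta> * 0 / \<kappa>)) (at_right 0)"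
  proof (intro tendsto_intros)
    show "((\<lambda>e::real. e powr (\<delta> - p)) \<longlongrightarrow> 0) (at_right 0)"
      using t by (intro tendsto_eq_intros tendsto_zero_powrI)
         (auto simp: eventually_at_right_less intro!: tendsto_eq_intros eventually_at_right_less[THEN eventually_mono])
  qed (use \<kappa> in auto)
  then have "\<forall>\<^sub>F e in at_right 0. 20 powr \<delta> * (2 powr \<delta> * e powr (\<delta> - p) / \<kappa>) < M"
    using M by (intro order_tendstoD(2)[of _ 0]) auto
  then obtain e0 :: real where e0: "e0 > 0" "\<And>e. 0 < e \<Longrightarrow> e < e0 \<Longrightarrow> 20 powr \<delta> * (2 powr \<delta> * e powr (\<delta> - p) / \<kappa>) < M"
    unfolding eventually_at_right_field by auto
  \<comment> \<open>The entry \<open>r / 4\<close> keeps balls of radius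
    \<open>2 * diameter (F n)\<close> about points of \<open>A\<close> inside
    \<open>ball z r\<close>; the entry 1 is the size limit in \<open>scale\<close>.\<close>
  define \<eta> where "\<eta> = Min {e0 / 2, r / 4, 1}"
  have \<eta>: "0 < \<eta>" "\<eta> < e0" "\<eta> \<le> r / 4" "\<eta> \<le> 1" using e0(1) r by (auto simp: \<eta>_def min_def)
  define \<beta> where "\<beta> = 2 powr \<delta> * \<eta> powr (\<delta> - p) / \<kappa>"
  have \<beta>: "0 \<le> \<beta>" "20 powr \<delta> * \<beta> < M" using e0(2)[OF \<eta>(1,2)] \<kappa> by (auto simp: \<beta>_def)
  have "hausdorff_content \<delta> A \<le> (ennreal M + ennreal (20 powr \<delta>) * ennreal \<beta>) * emeasure W ?I"
  proof (rule vitali_content_bound[where b = "2 * \<eta>", OF W(1)])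
    show "0 \<le> \<delta>" using t by simp
  next
    fix i assume i: "i \<in> ?I"
    have \<rho>: "0 < \<rho> i" using hits_ballD[OF i] by simp
    \<comment> \<open>A single cover ball costs at most the whole mass, which is below
      \<open>r powr t\<close> as \<open>c1 \<le> 1\<close>; so its diameter is at most
      \<open>r\<close>.\<close>
    have "emeasure W {i} \<le> emeasure W ?I" using i W by (intro emeasure_mono) auto
    then have "(2 * \<rho> i) powr t \<le> w" using W(2) w \<rho> by (simp add: ennreal_le_iff)
    also have "\<dots> \<le> r powr t" using wlt c1 mult_right_mono[of c1 1 "r powr t"] by simp
    finally have "2 * \<rho> i \<le> r"
      using \<rho> r t by (metis powr_less_mono2 leD less_imp_le linorder_not_less)
    then have "(2 * \<rho> i) powr (\<delta> - t) \<le> r powr (\<delta> - t)" using \<rho> t by (intro powr_mono2) auto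
    then have "5 powr \<delta> * ((2 * \<rho> i) powr (\<delta> - t) * (2 * \<rho> i) powr t) \<le> 5 powr \<delta> * (r powr (\<delta> - t) * (2 * \<rho> i) powr t)"
      by (intro mult_left_mono mult_right_mono) auto
    moreover have "(2 * (5 * \<rho> i)) powr \<delta> = 5 powr \<delta> * ((2 * \<rho> i) powr (\<delta> - t) * (2 * \<rho> i) powr t)"
      using \<rho> by (simp add: powr_mult[symmetric] powr_add[symmetric])
    ultimately show "ball_cost \<delta> (5 * \<rho> i) \<le> ennreal M * emeasure W {i}"
      unfolding W(2) using \<rho> M by (simp add: ennreal_mult[symmetric] M_def mult.assoc)
  next
    fix u assume u: "u \<in> A" and far: "\<forall>i\<in>?I. u \<notin> ball (y i) (5 * \<rho> i)"
    have freq: "\<exists>\<^sub>F n in sequentially. u \<in> F n" using u by (simp add: A_def mem_limsup_iff)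
    have "\<forall>\<^sub>F n in sequentially. diameter (F n) < \<eta>"
      using F(1) \<eta> by (intro order_tendstoD) auto
    then obtain n where n: "u \<in> F n" "diameter (F n) < \<eta>"
      using frequently_eventually_frequently[OF freq] by (metis (mono_tags, lifting) frequently_ex)
    let ?d = "diameter (F n)"
    have sub: "ball u (2 * ?d) \<subseteq> ball z r"
    proof
      fix a assume "a \<in> ball u (2 * ?d)"
      then show "a \<in> ball z r"
        using u n(2) \<eta>(3) dist_triangle[of z a u] by (simp add: A_def)
    qed
    have sub': "hits y \<rho> (ball u (2 * ?d)) \<subseteq> ?I" by (rule hits_mono[OF sub])
    \<comment> \<open>Since \<open>u\<close> avoids the 5-fold dilation,
      \<open>5 * \<rho> i \<le> dist u (y i) < 2 * ?d + \<rho> i\<close>. So cover balls near this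
      copy are no larger than the copy, as \<open>scale\<close> demands.\<close>
    have "2 * \<rho> i \<le> ?d" if i: "i \<in> hits y \<rho> (ball u (2 * ?d))" for i
    proof -
      have "i \<in> ?I" using sub' i by blast
      then have "5 * \<rho> i \<le> dist u (y i)" using far by (auto simp: dist_commute not_less)
      then show ?thesis using hits_ballD[OF i] by simp
    qed
    then have sc: "ennreal (\<kappa> * ?d powr p) \<le> emeasure W (hits y \<rho> (ball u (2 * ?d)))"
      using n sub \<eta> by (intro scale) auto
    have "(2 * ?d) powr \<delta> = 2 powr \<delta> * (?d powr (\<delta> - p) * ?d powr p)"
      using F(2)[of n] by (simp add: powr_mult powr_add[symmetric])
    also have "\<dots> \<le> 2 powr \<delta> * (\<eta> powr (\<delta> - p) * ?d powr p)"
      using n F(2)[of n] t by (intro mult_left_mono mult_right_mono powr_mono2) auto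
    also have "\<dots> = \<beta> * (\<kappa> * ?d powr p)" using \<kappa> by (simp add: \<beta>_def)
    finally have "ennreal ((2 * ?d) powr \<delta>) \<le> ennreal \<beta> * ennreal (\<kappa> * ?d powr p)"
      using \<beta> \<kappa> by (simp add: ennreal_mult[symmetric] ennreal_leI)
    also have "\<dots> \<le> ennreal \<beta> * emeasure W (hits y \<rho> (ball u (2 * ?d)))"
      by (intro mult_left_mono sc) auto
    finally show "\<exists>q. 0 < q \<and> q \<le> 2 * \<eta> \<and> hits y \<rho> (ball u q) \<subseteq> ?I \<and>
        ennreal (q powr \<delta>) \<le> ennreal \<beta> * emeasure W (hits y \<rho> (ball u q))"
      using F(2)[of n] n sub' by (intro exI[of _ "2 * ?d"]) auto
  qed
  also have "\<dots> = ennreal ((M + 20 powr \<delta> * \<beta>) * w)"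
    using M \<beta> w by (simp add: ennreal_mult[symmetric] ennreal_plus[symmetric] del: ennreal_plus)
  finally have cont: "hausdorff_content \<delta> A \<le> ennreal ((M + 20 powr \<delta> * \<beta>) * w)" .
  have "ennreal (measure \<mu> A) \<le> ennreal K * hausdorff_content \<delta> A"
    unfolding emeasure_eq_measure[symmetric] by (rule K) (auto simp: A_def)
  also have "\<dots> \<le> ennreal K * ennreal ((M + 20 powr \<delta> * \<beta>) * w)"
    by (intro mult_left_mono cont) auto
  finally have "measure \<mu> A \<le> K * ((M + 20 powr \<delta> * \<beta>) * w)"
    using K M \<beta> w by (simp add: ennreal_mult[symmetric])
  \<comment> \<open>Both terms fit into \<open>2 * M\<close> because
    \<open>20 powr \<delta> * \<beta> < M\<close>. The bound on \<open>c1\<close> is chosen so that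
    the result is half of \<open>k * (r / 2) powr \<delta>\<close>.\<close>
  also have "\<dots> \<le> K * ((2 * M) * (c1 * r powr t))"
    using K M \<beta> w wlt by (intro mult_left_mono mult_mono) auto
  also have "\<dots> = 2 * K * 5 powr \<delta> * r powr \<delta> * c1"
    using r by (simp add: M_def powr_add[symmetric])
  also have "\<dots> \<le> 2 * K * 5 powr \<delta> * r powr \<delta> * (k / (4 * K * 10 powr \<delta>))"
    using K c1 by (intro mult_left_mono) auto
  also have "\<dots> = k * (r / 2) powr \<delta> / 2"
  proof -
    have "10 powr \<delta> = 5 powr \<delta> * 2 powr \<delta>" by (simp add: powr_mult[symmetric])
    then show ?thesis using K r by (simp add: powr_divide)
  qed
  also have "\<dots> < k * (r / 2) powr \<delta>" using k r by simp
  finally show False using A by simp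
qed

section \<open>Refining light balls\<close>

text \<open>The conclusion is shaped for iteration: halving sends the radii to 0, closed balls
  inside open ones have traces on \<open>X\<close> with a common point, and the tail index
  \<open>N\<close> puts this point into infinitely many \<open>E n\<close>.\<close>

lemma refine_light_ball:
  fixes X :: "'a::euclidean_space set" and W :: "nat measure"
  assumes X: "compact X" "0 < diameter X"
    and W: "sets W = UNIV" "\<And>i. emeasure W {i} = ball_cost t (\<rho> i)"
    and t: "0 < t" "t < s" "t \<le> p" "p < \<delta>" "p = D - (s - t)"
    and \<mu>: "borel_prob_on X \<mu>" "measure \<mu> (limsup F) = 1"
    and k: "0 < k" "\<And>x r. x \<in> X \<Longrightarrow> 0 < r \<Longrightarrow> r \<le> diameter X \<Longrightarrow> k * r powr \<delta> \<le> measure \<mu> (ball x r \<inter> X)"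
    and K: "0 < K" "\<And>A. A \<subseteq> X \<Longrightarrow> emeasure \<mu> A \<le> ennreal K * hausdorff_content \<delta> A"
    and F: "\<And>n. F n \<subseteq> X" "(\<lambda>n. diameter (F n)) \<longlonglongrightarrow> 0" "\<And>n. 0 < diameter (F n)"
    and \<kappa>: "0 < \<kappa>" "\<And>n. ennreal (\<kappa> * diameter (F n) powr p) \<le>
       hausdorff_content p (F n \<inter> limsup (\<lambda>n. ball (x n) (r n) \<inter> X))"
    and r: "r \<longlonglongrightarrow> 0" "\<And>n. 0 < r n"
    and E: "\<And>n. openin (top_of_set X) (E n)" "\<And>n. E n \<subseteq> ball (x n) (r n) \<inter> X"
    and c: "0 < c" "\<And>n. ennreal (c * r n powr D) \<le> hausdorff_content s (E n)"
    and c1: "0 < c1" "c1 \<le> 1" "c1 \<le> k / (4 * K * 10 powr \<delta>)"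
    and z: "z \<in> X" "0 < q" "q \<le> diameter X"
    and light: "emeasure W (hits y \<rho> (ball z q)) < ennreal (c1 * q powr t)"
  shows "\<exists>z' q'. z' \<in> X \<and> 0 < q' \<and> q' \<le> q / 2 \<and> cball z' q' \<subseteq> ball z q \<and>
     cball z' q' \<inter> X \<subseteq> (\<Union>n\<in>{N..}. E n) \<and>
     emeasure W (hits y \<rho> (ball z' q')) < ennreal (c1 * q' powr t)"
proof (rule ccontr)
  assume "\<not> ?thesis"
  then have crowded: "ennreal (c1 * q' powr t) \<le> emeasure W (hits y \<rho> (ball z' q'))"
    if "z' \<in> X" "0 < q'" "q' \<le> q / 2" "cball z' q' \<subseteq> ball z q" "cball z' q' \<inter> X \<subseteq> (\<Union>n\<in>{N..}. E n)" for z' q'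
    using that not_le by blast
  define K1 where "K1 = max 1 ((5 powr s + 20 powr s / c1) / c)"
  \<comment> \<open>By \<open>r n \<le> q / 2\<close> and \<open>N \<le> n\<close>, every ball
    inside \<open>ball (x n) (r n)\<close> with centre in \<open>X\<close> and trace in
    \<open>E n\<close> is a candidate for the refinement, hence heavy.\<close>
  have est: "ennreal (r n powr p) \<le> ennreal K1 * emeasure W (hits y \<rho> (ball (x n) (r n)))"
    if n: "N \<le> n" "r n \<le> min 1 (q / 2)" "ball (x n) (r n) \<subseteq> ball z q" for n
    unfolding K1_def
  proof (rule open_subset_ball_cost_bound[where X = X and E = "E n" and D = D, OF W t(1,2) c(1) c1(1)])
    fix u q' assume u: "u \<in> X" "0 < q'" "cball u q' \<subseteq> ball (x n) (r n)" "cball u q' \<inter> X \<subseteq> E n"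
    have "cball u q' \<subseteq> cball (x n) (r n)" using u(3) by force
    then have "q' \<le> r n"
      using u(2) by (simp add: cball_subset_cball_iff) (smt (verit) zero_le_dist)
    then show "ennreal (c1 * q' powr t) \<le> emeasure W (hits y \<rho> (ball u q'))"
      using u n by (intro crowded) auto
  qed (use r n t E c in auto)
  define K2 where "K2 = 5 powr p + 20 powr p * (2 powr p * K1)"
  have K1: "1 \<le> K1" by (simp add: K1_def)
  then have K2: "K2 > 0" by (simp add: K2_def add_pos_nonneg)
  have scale: "ennreal (\<kappa> / K2 * diameter (F n) powr p) \<le> emeasure W (hits y \<rho> (ball w (2 * diameter (F n))))"
    if w: "w \<in> F n" "ball w (2 * diameter (F n)) \<subseteq> ball z q" "diameter (F n) \<le> 1"
      and small: "\<And>i. i \<in> hits y \<rho> (ball w (2 * diameter (F n))) \<Longrightarrow> 2 * \<rho> i \<le> diameter (F n)" for w n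
  proof -
    let ?H = "hits y \<rho> (ball w (2 * diameter (F n)))"
    have "ennreal (\<kappa> * diameter (F n) powr p) \<le> hausdorff_content p (F n \<inter> limsup (\<lambda>n. ball (x n) (r n) \<inter> X))"
      by (rule \<kappa>)
    also have "\<dots> \<le> ennreal K2 * emeasure W ?H"
      unfolding K2_def
    proof (rule copy_cost_bound[where N = N and R = "min 1 (q / 2)", OF W])
      show "bounded (F n)" using F(1) X(1) by (meson bounded_subset compact_imp_bounded)
      show "2 * \<rho> i \<le> 1" if "i \<in> ?H" for i using small[OF that] w(3) by simp
      show "ennreal (r m powr p) \<le> ennreal K1 * emeasure W (hits y \<rho> (ball (x m) (r m)))"
        if "N \<le> m" "r m \<le> min 1 (q / 2)" "ball (x m) (r m) \<subseteq> ball w (2 * diameter (F n))" for m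
        using that w(2) by (intro est) auto
    qed (use t K1 F w r z in auto)
    finally have "ennreal (1 / K2) * ennreal (\<kappa> * diameter (F n) powr p)
        \<le> ennreal (1 / K2) * (ennreal K2 * emeasure W ?H)"
      by (rule mult_left_mono) simp
    then show ?thesis
      using K2 \<kappa>(1) by (simp add: mult.assoc[symmetric] ennreal_mult[symmetric])
  qed
  show False
    by (rule vitali_family_contradiction[where F = F and \<kappa> = "\<kappa> / K2" and z = z and r = q,
          OF W t(1,3,4) _ \<mu> k(1) _ K F(2,3) _ c1 light scale])
       (use \<kappa> K2 z k(2)[of z "q / 2"] in auto)
qed

section \<open>Degenerate spaces, comparison of exponents, and dimension\<close>

lemma hausdorff_content_eq_0_of_diameter_0:
  fixes X :: "'a::euclidean_space set"
  assumes "bounded X" "diameter X = 0" "0 < s"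
  shows "hausdorff_content s X = 0"
proof -
  have "\<exists>a. X \<subseteq> {a}"
    using assms(1,2) diameter_bounded_bound[of X] by (metis dist_le_zero_iff insertCI subsetI)
  then obtain a where a: "X \<subseteq> {a}" by blast
  have "((\<lambda>e::real. ennreal ((2 * e) powr s)) \<longlongrightarrow> ennreal 0) (at_right 0)"
    using assms(3) by (intro tendsto_ennrealI tendsto_zero_powrI tendsto_eq_intros)
      (auto simp: eventually_at_right_less intro!: eventually_at_right_less[THEN eventually_mono])
  moreover have "\<forall>\<^sub>F e in at_right 0. hausdorff_content s X \<le> ennreal ((2 * e) powr s)"
    unfolding eventually_at_right_field
  proof (intro exI[of _ 1] conjI allI impI)
    fix e :: real assume "0 < e"
    have "hausdorff_content s X \<le> hausdorff_content s (ball a e)"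
      using a \<open>0 < e\<close> by (intro hausdorff_content_mono) auto
    also have "\<dots> \<le> ball_cost s e" by (rule hausdorff_content_ball_le)
    finally show "hausdorff_content s X \<le> ennreal ((2 * e) powr s)" using \<open>0 < e\<close> by simp
  qed simp
  ultimately have "hausdorff_content s X \<le> ennreal 0"
    by (intro tendsto_lowerbound[where F="at_right 0"]) auto
  then show ?thesis by simp
qed

text \<open>Since \<open>E n\<close> lies in a ball of radius \<open>r n\<close>, its content is at
  most \<open>(2 * r n) powr s\<close>. For \<open>s > D\<close>, division by
  \<open>r n powr D\<close> would bound \<open>c\<close> by a sequence tending to 0.\<close>

lemma content_exponent_le:
  fixes E :: "nat \<Rightarrow> 'a::euclidean_space set"
  assumes r: "r \<longlonglongrightarrow> 0" "\<And>n. 0 < r n" and E: "\<And>n. E n \<subseteq> ball (x n) (r n)"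
    and c: "0 < c" "\<And>n. ennreal (c * r n powr D) \<le> hausdorff_content s (E n)"
  shows "s \<le> D"
proof (rule ccontr)
  assume "\<not> s \<le> D"
  have "c \<le> 2 powr s * r n powr (s - D)" for n
  proof -
    have "ennreal (c * r n powr D) \<le> hausdorff_content s (ball (x n) (r n))"
      using c(2) hausdorff_content_mono[OF E] order_trans by blast
    also have "\<dots> \<le> ball_cost s (r n)" by (rule hausdorff_content_ball_le)
    finally have "c * r n powr D \<le> (2 * r n) powr s" using r(2)[of n] by (simp add: max_def)
    also have "\<dots> = 2 powr s * r n powr (s - D) * r n powr D"
      using r(2)[of n] by (simp add: powr_mult powr_add[symmetric])
    finally show ?thesis using r(2)[of n] by simp
  qed
  moreover have "(\<lambda>n. 2 powr s * r n powr (s - D)) \<longlonglongrightarrow> 2 powr s * 0"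
    using \<open>\<not> s \<le> D\<close> r by (intro tendsto_mult tendsto_const tendsto_zero_powrI[OF r(1), of _ "s - D"])
      (auto intro!: always_eventually less_imp_le)
  ultimately have "c \<le> 2 powr s * 0"
    by (intro LIMSEQ_le_const[where X = "\<lambda>n. 2 powr s * r n powr (s - D)"]) blast+
  then show False using c(1) by simp
qed

text \<open>A null set for the measure of exponent \<open>t < s\<close> has covers of arbitrarily
  small \<open>t\<close>-cost by balls of diameter at most 1. For these the \<open>s\<close>-cost is
  no larger, so the \<open>s\<close>-content would vanish.\<close>

lemma le_hausdorff_dim:
  fixes X :: "'a::euclidean_space set"
  assumes s: "0 \<le> s" and pos: "0 < s \<Longrightarrow> hausdorff_content s X \<noteq> 0"
  shows "ereal s \<le> hausdorff_dim X"
  unfolding hausdorff_dim_def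
proof (rule Inf_greatest, clarify)
  fix t assume t: "0 \<le> t" "hausdorff_measure t X = 0"
  show "ereal s \<le> ereal t"
  proof (rule ccontr)
    assume "\<not> ?thesis"
    then have ts: "t < s" by simp
    have "hausdorff_content s X \<le> ennreal e" if e: "0 < e" for e
    proof -
      have "(INF (x, r) \<in> {(x :: nat \<Rightarrow> 'a, r :: nat \<Rightarrow> real).
                      X \<subseteq> (\<Union>i. ball (x i) (r i)) \<and> (\<forall>i. diameter (ball (x i) (r i)) \<le> 1)}.
          \<Sum>i. ennreal (diameter (ball (x i) (r i)) powr t)) \<le> hausdorff_measure t X"
        unfolding hausdorff_measure_def by (rule SUP_upper) simp
      also have "\<dots> < ennreal e" using t e by simp
      finally obtain a b where ab: "X \<subseteq> (\<Union>i::nat. ball (a i) (b i))" "\<And>i. diameter (ball (a i) (b i)) \<le> 1"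
          "(\<Sum>i. ennreal (diameter (ball (a i) (b i)) powr t)) < ennreal e"
        unfolding INF_less_iff by auto
      have "hausdorff_content s X \<le> (\<Sum>i. ennreal (diameter (ball (a i) (b i)) powr s))"
        unfolding hausdorff_content_def by (rule INF_lower2[of "(a, b)"]) (use ab in auto)
      also have "\<dots> \<le> (\<Sum>i. ennreal (diameter (ball (a i) (b i)) powr t))"
        using ab(2) ts by (intro suminf_le summableI ennreal_leI powr_mono' diameter_ge_0) (auto simp del: diameter_ball)
      finally show ?thesis using ab(3) by simp
    qed
    then have "hausdorff_content s X = 0"
      by (metis add.left_neutral ennreal_le_epsilon le_zero_eq)
    then show False using pos ts t by simp
  qed
qed

lemma gdelta_in_limsup:
  assumes "\<And>n. openin (top_of_set X) (E n)"
  shows "gdelta_in (top_of_set X) (limsup E)"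
  unfolding limsup_INF_SUP
  by (intro gdelta_in_Inter) (auto intro!: open_imp_gdelta_in openin_Union assms)

section \<open>The content bound from nested light balls\<close>

lemma limsup_content_bound:
  fixes X :: "'a::euclidean_space set" and F E :: "nat \<Rightarrow> 'a set"
  assumes X: "compact X" and \<mu>: "ahlfors_regular X \<delta> \<mu>" and \<nu>: "borel_prob_on X \<nu>"
    and F: "\<And>n. F n \<subseteq> X" "\<And>n. closed (F n)" "(\<lambda>n. diameter (F n)) \<longlonglongrightarrow> 0"
    and qsc: "quasi_self_conformal X \<nu> F" and full: "measure \<mu> (limsup F) = 1"
    and r: "r \<longlonglongrightarrow> 0" "\<And>n. 0 < r n"
    and E: "\<And>n. openin (top_of_set X) (E n)" "\<And>n. E n \<subseteq> ball (x n) (r n) \<inter> X"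
    and L: "measure \<nu> (limsup (\<lambda>n. ball (x n) (r n) \<inter> X)) = 1"
    and s: "0 < s"
    and c: "0 < c" "\<And>n. ennreal (c * r n powr real_of_ereal (upper_hausdorff_dim \<nu>)) \<le> hausdorff_content s (E n)"
  shows "\<exists>c'>0. \<forall>t. 0 < t \<and> t < s \<longrightarrow> (\<forall>z\<in>X. \<forall>R>0.
      ennreal c' * hausdorff_content t (ball z R \<inter> X) < hausdorff_content t (limsup E \<inter> (ball z R \<inter> X)))"
proof -
  interpret N: prob_space \<nu> using borel_prob_onD(1)[OF \<nu>] .
  have \<mu>b: "borel_prob_on X \<mu>" using \<mu> by (simp add: ahlfors_regular_def)
  define D where "D = real_of_ereal (upper_hausdorff_dim \<nu>)"
  note c = c[folded D_def]
  have "s \<le> D" using E(2) by (intro content_exponent_le[OF r _ c]) auto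
  \<comment> \<open>\<open>real_of_ereal\<close> sends infinite values to \<open>0\<close>, which \<open>0 < s \<le> D\<close> excludes.\<close>
  then have dim: "upper_hausdorff_dim \<nu> = ereal D"
    using s unfolding D_def by (cases "upper_hausdorff_dim \<nu>") auto
  then have top: "upper_hausdorff_dim \<nu> \<noteq> \<infinity>" by simp
  have less_dim: "ereal p < upper_hausdorff_dim \<nu>" if "p < D" for p
    using that by (simp add: dim)
  have diam: "0 < diameter X"
  proof (rule ccontr)
    assume "\<not> ?thesis"
    then have "diameter X = 0"
      using diameter_ge_0[OF compact_imp_bounded[OF X]] by simp
    then have "hausdorff_content s X = 0"
      by (rule hausdorff_content_eq_0_of_diameter_0[OF compact_imp_bounded[OF X] _ s])
    moreover have "hausdorff_content s (E 0) \<le> hausdorff_content s X"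
      using E(2) by (intro hausdorff_content_mono) auto
    ultimately have "ennreal (c * r 0 powr D) \<le> 0" using c(2)[of 0] by simp
    then show False using c(1) r(2)[of 0] by (simp add: mult_le_0_iff)
  qed
  \<comment> \<open>An exponent \<open>p\<close> strictly between would give \<open>F 0\<close>
    positive \<open>p\<close>-content inside \<open>X\<close>, whose \<open>p\<close>-content
    vanishes. Taking \<open>max \<delta> 0\<close> keeps \<open>p\<close> nonnegative, the sign of
    \<open>\<delta>\<close> being unknown so far.\<close>
  have "D \<le> \<delta>"
  proof (rule ccontr)
    assume "\<not> D \<le> \<delta>"
    define p where "p = (max \<delta> 0 + D) / 2"
    have p: "0 \<le> p" "p < D" "\<delta> < p" using \<open>\<not> D \<le> \<delta>\<close> \<open>s \<le> D\<close> s by (auto simp: p_def max_def)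
    obtain \<kappa> where \<kappa>: "\<kappa> > 0" "\<forall>n. 0 < diameter (F n)"
        "\<forall>n L. measure \<nu> L = 1 \<longrightarrow> ennreal (\<kappa> * diameter (F n) powr p) \<le> hausdorff_content p (F n \<inter> L)"
      by (rule quasi_self_conformal_content_bound[OF X diam \<nu> F(1,2) qsc top p(1) less_dim[OF p(2)]])
    have "ennreal (\<kappa> * diameter (F 0) powr p) \<le> hausdorff_content p (F 0 \<inter> X)"
      using N.prob_space borel_prob_onD(2)[OF \<nu>] by (intro \<kappa>(3)[rule_format]) simp
    also have "\<dots> \<le> hausdorff_content p X" by (rule hausdorff_content_mono) auto
    also have "\<dots> = 0" by (rule ahlfors_content_eq_0[OF \<mu> diam p(3,1)])
    finally show False using \<kappa>(1) \<kappa>(2)[rule_format, of 0] by (simp add: mult_le_0_iff)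
  qed
  then have "0 \<le> \<delta>" using \<open>s \<le> D\<close> s by simp
  obtain k K where k: "0 < k" "\<forall>x r. x \<in> X \<longrightarrow> 0 < r \<longrightarrow> r \<le> diameter X \<longrightarrow> k * r powr \<delta> \<le> measure \<mu> (ball x r \<inter> X)"
    and K: "0 < K" "\<forall>A. A \<subseteq> X \<longrightarrow> emeasure \<mu> A \<le> ennreal K * hausdorff_content \<delta> A"
    by (rule ahlfors_regularE[OF \<mu> diam \<open>0 \<le> \<delta>\<close>])
  define c1 where "c1 = min 1 (k / (4 * K * 10 powr \<delta>))"
  have c1: "0 < c1" "c1 \<le> 1" "c1 \<le> k / (4 * K * 10 powr \<delta>)" using k K by (auto simp: c1_def)
  \<comment> \<open>The witness must not depend on \<open>t\<close>. The set
    \<open>ball z R \<inter> X\<close> lies in a ball of diameter \<open>4 * R'\<close>, and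
    \<open>4 powr t\<close> is replaced by \<open>4 powr s\<close>; the factor 2 yields the strict
    inequality.\<close>
  show ?thesis
  proof (intro exI[of _ "c1 / (2 * 4 powr s)"] conjI allI impI ballI)
    show "0 < c1 / (2 * 4 powr s)" using c1 by simp
    fix t z R assume t: "0 < t \<and> t < s" and z: "z \<in> X" and R: "(0::real) < R"
    \<comment> \<open>The gap \<open>p < D\<close> provides \<open>\<kappa>\<close>, which may
      depend on \<open>t\<close>; this is harmless because \<open>c1\<close> is already
      fixed.\<close>
    define p where "p = D - (s - t)"
    have p: "t \<le> p" "p < \<delta>" "p < D" "0 \<le> p" using t \<open>s \<le> D\<close> \<open>D \<le> \<delta>\<close> by (auto simp: p_def)
    obtain \<kappa> where \<kappa>: "\<kappa> > 0" and Fpos: "\<forall>n. 0 < diameter (F n)" and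
        \<kappa>le: "\<forall>n L. measure \<nu> L = 1 \<longrightarrow> ennreal (\<kappa> * diameter (F n) powr p) \<le> hausdorff_content p (F n \<inter> L)"
      by (rule quasi_self_conformal_content_bound[OF X diam \<nu> F(1,2) qsc top p(4) less_dim[OF p(3)]])
    define R' where "R' = min R (diameter X)"
    have R': "0 < R'" "R' \<le> R" "R' \<le> diameter X" using R diam by (auto simp: R'_def)
    show "ennreal (c1 / (2 * 4 powr s)) * hausdorff_content t (ball z R \<inter> X) < hausdorff_content t (limsup E \<inter> (ball z R \<inter> X))"
    proof (rule ccontr)
      assume not: "\<not> ?thesis"
      \<comment> \<open>Distances in \<open>X\<close> may equal \<open>diameter X\<close>, which an
        open ball of that radius would miss; hence the doubling.\<close>
      have "ball z R \<inter> X \<subseteq> ball z (2 * R')"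
      proof
        fix v assume v: "v \<in> ball z R \<inter> X"
        then have "dist z v \<le> diameter X"
          using z X by (intro diameter_bounded_bound) (auto simp: compact_imp_bounded)
        then show "v \<in> ball z (2 * R')" using v R' by (auto simp: R'_def min_def)
      qed
      then have "hausdorff_content t (ball z R \<inter> X) \<le> ball_cost t (2 * R')"
        using hausdorff_content_mono hausdorff_content_ball_le order_trans by blast
      also have "\<dots> \<le> ennreal (4 powr s * R' powr t)"
      proof -
        have "(4 * R') powr t = 4 powr t * R' powr t" using R' by (simp add: powr_mult)
        also have "\<dots> \<le> 4 powr s * R' powr t" using t by (intro mult_right_mono powr_mono) auto
        finally show ?thesis using R' by (simp add: ennreal_leI)
      qed
      finally have up: "hausdorff_content t (ball z R \<inter> X) \<le> ennreal (4 powr s * R' powr t)" .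
      have "hausdorff_content t (limsup E \<inter> (ball z R' \<inter> X)) \<le> hausdorff_content t (limsup E \<inter> (ball z R \<inter> X))"
        using R' by (intro hausdorff_content_mono) auto
      also have "\<dots> \<le> ennreal (c1 / (2 * 4 powr s)) * hausdorff_content t (ball z R \<inter> X)"
        using not by simp
      also have "\<dots> \<le> ennreal (c1 / (2 * 4 powr s)) * ennreal (4 powr s * R' powr t)"
        by (intro mult_left_mono up) simp
      also have "\<dots> = ennreal (c1 * R' powr t / 2)"
        using c1 by (simp add: ennreal_mult[symmetric])
      also have "\<dots> < ennreal (c1 * R' powr t)"
        using c1 R' by (intro ennreal_lessI) auto
      finally obtain y \<rho> where cov: "limsup E \<inter> (ball z R' \<inter> X) \<subseteq> (\<Union>i. ball (y i) (\<rho> i))"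
          "(\<Sum>i. ball_cost t (\<rho> i)) < ennreal (c1 * R' powr t)"
        by (rule hausdorff_content_lessE)
      define W where "W = density (count_space UNIV) (\<lambda>i. ball_cost t (\<rho> i))"
      have Wsets: "sets W = UNIV" by (simp add: W_def)
      have Wsing: "emeasure W {i} = ball_cost t (\<rho> i)" for i
        by (simp add: W_def emeasure_density nn_integral_count_space_indicator[symmetric] nn_integral_count_space_finite)
      have Wall: "emeasure W UNIV = (\<Sum>i. ball_cost t (\<rho> i))"
        by (simp add: W_def emeasure_density nn_integral_count_space_nat)
      \<comment> \<open>Containment in \<open>ball z R'\<close> belongs to the invariant because the
        dependent choice below does not prescribe the first ball, while the cover is only known to
        work inside \<open>ball z R'\<close>.\<close>
      define P where "P = (\<lambda>(u, q). u \<in> X \<and> 0 < q \<and> q \<le> diameter X \<and> ball u q \<subseteq> ball z R' \<and>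
          emeasure W (hits y \<rho> (ball u q)) < ennreal (c1 * q powr t))"
      define Q where "Q = (\<lambda>N (u, q) (u', q'). q' \<le> q / 2 \<and> cball u' q' \<subseteq> ball u q \<and>
          cball u' q' \<inter> X \<subseteq> (\<Union>n\<in>{N..}. E n))"
      have "\<exists>f. \<forall>n. P (f n) \<and> Q n (f n) (f (Suc n))"
      proof -
        have "P (z, R')"
        proof -
          have "emeasure W (hits y \<rho> (ball z R')) \<le> emeasure W UNIV"
            using Wsets by (intro emeasure_mono) auto
          then show ?thesis using z R' cov(2) Wall by (auto simp: P_def)
        qed
        moreover have "\<exists>b. P b \<and> Q N a b" if "P a" for a :: "'a \<times> real" and N
        proof -
          obtain u q where a: "a = (u, q)" by (cases a)
          have u: "u \<in> X" "0 < q" "q \<le> diameter X" "ball u q \<subseteq> ball z R'"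
            "emeasure W (hits y \<rho> (ball u q)) < ennreal (c1 * q powr t)"
            using that by (auto simp: P_def a)
          have "\<exists>u' q'. u' \<in> X \<and> 0 < q' \<and> q' \<le> q / 2 \<and> cball u' q' \<subseteq> ball u q \<and>
             cball u' q' \<inter> X \<subseteq> (\<Union>n\<in>{N..}. E n) \<and>
             emeasure W (hits y \<rho> (ball u' q')) < ennreal (c1 * q' powr t)"
            using t p by (intro refine_light_ball[OF X diam Wsets Wsing _ _ p(1,2) p_def \<mu>b full k(1) k(2)[rule_format] K(1) K(2)[rule_format] F(1,3) Fpos[rule_format] \<kappa> \<kappa>le[rule_format, OF L]
               r E c c1 u(1,2,3,5)]) auto
          then obtain u' q' where u': "u' \<in> X" "0 < q'" "q' \<le> q / 2" "cball u' q' \<subseteq> ball u q"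
             "cball u' q' \<inter> X \<subseteq> (\<Union>n\<in>{N..}. E n)"
             "emeasure W (hits y \<rho> (ball u' q')) < ennreal (c1 * q' powr t)" by blast
          have "ball u' q' \<subseteq> ball z R'" using u'(4) u(4) ball_subset_cball by blast
          then have "P (u', q')" using u u' by (simp add: P_def)
          moreover have "Q N a (u', q')" using u' by (simp add: Q_def a)
          ultimately show ?thesis by blast
        qed
        ultimately show ?thesis
          by (intro dependent_nat_choice) blast+
      qed
      then obtain f where f: "\<And>n. P (f n)" "\<And>n. Q n (f n) (f (Suc n))" by blast
      define u q where "u n = fst (f n)" and "q n = snd (f n)" for n
      have fn: "f n = (u n, q n)" for n by (simp add: u_def q_def)
      have u: "u n \<in> X" "0 < q n" "q n \<le> diameter X" "ball (u n) (q n) \<subseteq> ball z R'"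
          "emeasure W (hits y \<rho> (ball (u n) (q n))) < ennreal (c1 * q n powr t)" for n
        using f(1)[of n] by (auto simp: P_def fn)
      have step: "q (Suc n) \<le> q n / 2" "cball (u (Suc n)) (q (Suc n)) \<subseteq> ball (u n) (q n)"
          "cball (u (Suc n)) (q (Suc n)) \<inter> X \<subseteq> (\<Union>m\<in>{n..}. E m)" for n
        using f(2)[of n] by (auto simp: Q_def fn)
      have dec: "decseq (\<lambda>n. cball (u n) (q n) \<inter> X)"
        using step(2) ball_subset_cball by (intro decseq_SucI) blast
      have "(\<Inter>n. cball (u n) (q n) \<inter> X) \<noteq> {}"
      proof (rule compact_nest)
        show "compact (cball (u n) (q n) \<inter> X)" for n using X by (simp add: closed_Int_compact)
        show "cball (u n) (q n) \<inter> X \<noteq> {}" for n using u(1,2)[of n] by force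
        show "cball (u n) (q n) \<inter> X \<subseteq> cball (u m) (q m) \<inter> X" if "m \<le> n" for m n
          using dec that by (rule decseqD)
      qed
      then obtain a where a: "\<And>n. a \<in> cball (u n) (q n)" "a \<in> X" by blast
      have aball: "a \<in> ball (u n) (q n)" for n using a(1)[of "Suc n"] step(2) by blast
      have "a \<in> limsup E"
        unfolding limsup_INF_SUP using a step(3) by blast
      have "a \<in> ball z R'"
        using aball[of 0] u(4)[of 0] by blast
      then obtain i where i: "a \<in> ball (y i) (\<rho> i)" using cov(1) a(2) \<open>a \<in> limsup E\<close> by blast
      \<comment> \<open>The cover ball containing \<open>a\<close> meets every ball of the sequence,
        so its cost is bounded by quantities tending to 0, which its positive radius
        forbids.\<close>
      have "ball_cost t (\<rho> i) \<le> ennreal (c1 * q n powr t)" for n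
      proof -
        have "i \<in> hits y \<rho> (ball (u n) (q n))" using i aball by (auto simp: hits_def)
        then have "emeasure W {i} \<le> emeasure W (hits y \<rho> (ball (u n) (q n)))"
          using Wsets by (intro emeasure_mono) auto
        then show ?thesis using u(5)[of n] Wsing by simp
      qed
      moreover have "(\<lambda>n. ennreal (c1 * q n powr t)) \<longlonglongrightarrow> ennreal (c1 * 0)"
      proof (intro tendsto_ennrealI tendsto_mult tendsto_const tendsto_zero_powrI)
        have "q n \<le> q 0 * (1 / 2) ^ n" for n
        proof (induction n)
          case (Suc n)
          then show ?case using step(1)[of n] by simp
        qed simp
        moreover have "(\<lambda>n. q 0 * (1 / 2) ^ n) \<longlonglongrightarrow> q 0 * 0"
          by (intro tendsto_mult tendsto_const LIMSEQ_realpow_zero) auto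
        ultimately show "q \<longlonglongrightarrow> 0"
          using u(2) by (intro tendsto_sandwich[of "\<lambda>_. 0" q sequentially "\<lambda>n. q 0 * (1 / 2) ^ n"])
            (auto intro!: always_eventually less_imp_le)
      qed (use t u(2) in \<open>auto intro!: always_eventually less_imp_le\<close>)
      ultimately have "ball_cost t (\<rho> i) \<le> ennreal (c1 * 0)"
        by (intro LIMSEQ_le_const[where X = "\<lambda>n. ennreal (c1 * q n powr t)"]) blast+
      moreover have "0 < \<rho> i" using i le_less_trans[OF zero_le_dist] by auto
      ultimately show False by simp
    qed
  qed
qed

theorem theorem1p5:
  fixes X :: "(real ^ 'd) set" and \<delta> s c :: real
    and \<mu> \<nu> :: "(real ^ 'd) measure"
    and F E :: "nat \<Rightarrow> (real ^ 'd) set"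
    and x :: "nat \<Rightarrow> real ^ 'd" and r :: "nat \<Rightarrow> real"
  assumes "compact X"
    and "ahlfors_regular X \<delta> \<mu>"
    and "borel_prob_on X \<nu>"
    and "\<And>n. F n \<subseteq> X" and "\<And>n. closed (F n)"
    and "(\<lambda>n. diameter (F n)) \<longlonglongrightarrow> 0"
    and "quasi_self_conformal X \<nu> F"
    and "measure \<mu> (limsup F) = 1"
    and "\<And>n. x n \<in> X" and "\<And>n. r n > 0"
    and "\<And>n. openin (top_of_set X) (E n)"
    and "r \<longlonglongrightarrow> 0"
    and "measure \<nu> (limsup (\<lambda>n. ball (x n) (r n) \<inter> X)) = 1"
    and "\<And>n. E n \<subseteq> ball (x n) (r n) \<inter> X"
    and "s \<ge> 0" and "c > 0"
    and "\<And>n. hausdorff_content s (E n) \<ge>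
           ennreal (c * r n powr real_of_ereal (upper_hausdorff_dim \<nu>))"
  shows "limsup E \<in> large_intersection_class s X"
proof -
  have "hausdorff_content s X \<noteq> 0"
  proof
    assume "hausdorff_content s X = 0"
    moreover have "hausdorff_content s (E 0) \<le> hausdorff_content s X"
      using assms(14) by (intro hausdorff_content_mono) auto
    ultimately have "ennreal (c * r 0 powr real_of_ereal (upper_hausdorff_dim \<nu>)) \<le> 0"
      using assms(17)[of 0] by simp
    then show False using assms(10)[of 0] assms(16) by (simp add: mult_le_0_iff)
  qed
  then have "ereal s \<le> hausdorff_dim X" using assms(15) by (intro le_hausdorff_dim)
  moreover have "gdelta_in (top_of_set X) (limsup E)" by (intro gdelta_in_limsup assms)
  moreover have "\<exists>c'>0. \<forall>t. 0 < t \<and> t < s \<longrightarrow> (\<forall>z\<in>X. \<forall>R>0.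
      hausdorff_content t (limsup E \<inter> (ball z R \<inter> X)) > ennreal c' * hausdorff_content t (ball z R \<inter> X))"
  proof (cases "s = 0")
    case True
    then show ?thesis by (intro exI[of _ 1]) auto
  next
    case False
    with assms(15) have "0 < s" by simp
    then show ?thesis
      by (intro limsup_content_bound[where c = c and x = x and r = r and F = F and \<mu> = \<mu> and \<nu> = \<nu> and \<delta> = \<delta>] assms)
  qed
  ultimately show ?thesis using assms(15) by (simp add: large_intersection_class_def)
qed

end
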